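(* The commutative algebra $\mathcal A_{q=1,t}$ is a flat deformation of $\mathcal A_{q=t=1}$: there is a set $B$ of monomials in the 15 generators whose images form a basis of $\mathcal A_{q=1,t}$ over $\mathbb C(t^{1/4})$ and also a basis of $\mathcal A_{q=t=1}$ over $\mathbb C$, such that the structure constants of $\mathcal A_{q=1,t}$ in the basis $B$ lie in $\mathbb C[t^{\pm1/4}]$ and specialize at $t^{1/4}=1$ to the structure constants of $\mathcal A_{q=t=1}$ in the basis $B$.
   Context: The 15 commuting generators are $O_1,\dots,O_6$, $O_{12},O_{23},O_{34},O_{45},O_{56},O_{61}$, $O_{123},O_{234},O_{345}$. Indices are read cyclically modulo 6 with values in $\{1,\dots,6\}$, and $O_{456}:=O_{123}$, $O_{561}:=O_{234}$, $O_{612}:=O_{345}$. $\mathcal A_{q=1,t}$ is the commutative algebra over $\mathbf k_t=\mathbb C(t^{1/4})$ with these generators and relations, where $\kappa=t^{1/2}+t^{-1/2}$ ($1\le i\le6$): (a) $O_{i+2}O_{i+4}+O_{i+3}O_{i+2,i+3,i+4}-O_{i+2,i+3}O_{i+3,i+4}-\kappa O_i=0$; (b) $-O_{i+3}O_{i+5,i}-O_{i+4}O_{i+1,i+2}+O_{i+3,i+4}O_{i+1,i+2,i+3}-\kappa(O_{i,i+1}-O_iO_{i+1})=0$; (c) $-O_{i+1,i+2}O_{i+4,i+5}+O_{i,i+1,i+2}O_{i+1,i+2,i+3}-O_iO_{i+3}-\kappa(-O_{i+2,i+3,i+4}+O_{i+1}O_{i+5,i}+O_{i+5}O_{i,i+1}-O_iO_{i+1}O_{i+5})=0$;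 (d) $O_{123}O_{234}O_{345}-(O_1O_4O_{345}+O_2O_5O_{123}+O_3O_6O_{234})+\frac\kappa2(O_1O_6O_{61}+O_2O_1O_{12}+O_3O_2O_{23}+O_4O_3O_{34}+O_5O_4O_{45}+O_6O_5O_{56})-(O_1O_3O_5+O_2O_4O_6)-\frac\kappa2(O_{12}^2+O_{23}^2+O_{34}^2+O_{45}^2+O_{56}^2+O_{61}^2)+\kappa^3=0$. $\mathcal A_{q=t=1}$ is the commutative algebra over $\mathbb C$ with the same generators and the relations (a)-(d) with $t=1$, i.e. $\kappa=2$. *)

theory Defs
  imports
    "HOL-Library.Poly_Mapping"
    "HOL-Computational_Algebra.Polynomial"
    "HOL-Computational_Algebra.Fraction_Field"
    "HOL-Algebra.QuotRing"
    "Jordan_Normal_Form.VS_Connect"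
begin

datatype gen = O1 | O2 | O3 | O4 | O5 | O6
  | O12 | O23 | O34 | O45 | O56 | O61
  | O123 | O234 | O345

type_synonym monomial = "gen \<Rightarrow>\<^sub>0 nat"
type_synonym 'k gpoly = "monomial \<Rightarrow>\<^sub>0 'k"

definition var :: "gen \<Rightarrow> 'k::field gpoly" where
  "var g = Poly_Mapping.single (Poly_Mapping.single g 1) 1"

definition const :: "'k::field \<Rightarrow> 'k gpoly" where
  "const c = Poly_Mapping.single 0 c"

definition mono_poly :: "monomial \<Rightarrow> 'k::field gpoly" where
  "mono_poly m = Poly_Mapping.single m 1"


text \<open>
  \<open>oo1 i\<close>, \<open>oo2 i\<close>, \<open>oo3 i\<close> are $O_i$, $O_{i,i+1}$ and $O_{i,i+1,i+2}$, indices modulo 6.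
  The list position 0 stands for the index 6. In \<open>oo3\<close>, the positions 0, 4 and 5 are
  $O_{612} = O_{345}$, $O_{456} = O_{123}$ and $O_{561} = O_{234}$.
\<close>

definition oo1 :: "nat \<Rightarrow> 'k::field gpoly" where
  "oo1 i = var ([O6, O1, O2, O3, O4, O5] ! (i mod 6))"

definition oo2 :: "nat \<Rightarrow> 'k::field gpoly" where
  "oo2 i = var ([O61, O12, O23, O34, O45, O56] ! (i mod 6))"

definition oo3 :: "nat \<Rightarrow> 'k::field gpoly" where
  "oo3 i = var ([O345, O123, O234, O345, O123, O234] ! (i mod 6))"

definition rel_a :: "'k::field \<Rightarrow> nat \<Rightarrow> 'k gpoly" where
  "rel_a \<kappa> i =
     oo1 (i+2) * oo1 (i+4) + oo1 (i+3) * oo3 (i+2) - oo2 (i+2) * oo2 (i+3) - const \<kappa> * oo1 i"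

definition rel_b :: "'k::field \<Rightarrow> nat \<Rightarrow> 'k gpoly" where
  "rel_b \<kappa> i =
     - oo1 (i+3) * oo2 (i+5) - oo1 (i+4) * oo2 (i+1) + oo2 (i+3) * oo3 (i+1)
     - const \<kappa> * (oo2 i - oo1 i * oo1 (i+1))"

definition rel_c :: "'k::field \<Rightarrow> nat \<Rightarrow> 'k gpoly" where
  "rel_c \<kappa> i =
     - oo2 (i+1) * oo2 (i+4) + oo3 i * oo3 (i+1) - oo1 i * oo1 (i+3)
     - const \<kappa> * (- oo3 (i+2) + oo1 (i+1) * oo2 (i+5) + oo1 (i+5) * oo2 i
                     - oo1 i * oo1 (i+1) * oo1 (i+5))"

definition rel_d :: "'k::field \<Rightarrow> 'k gpoly" where
  "rel_d \<kappa> =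
     var O123 * var O234 * var O345
     - (var O1 * var O4 * var O345 + var O2 * var O5 * var O123 + var O3 * var O6 * var O234)
     + const (\<kappa> / 2) *
         (var O1 * var O6 * var O61 + var O2 * var O1 * var O12 + var O3 * var O2 * var O23
          + var O4 * var O3 * var O34 + var O5 * var O4 * var O45 + var O6 * var O5 * var O56)
     - (var O1 * var O3 * var O5 + var O2 * var O4 * var O6)
     - const (\<kappa> / 2) *
         ((var O12)^2 + (var O23)^2 + (var O34)^2 + (var O45)^2 + (var O56)^2 + (var O61)^2)
     + const (\<kappa>^3)"

definition relations :: "'k::field \<Rightarrow> 'k gpoly set" where
  "relations \<kappa> =
     rel_a \<kappa> ` {1..6} \<union> rel_b \<kappa> ` {1..6} \<union> rel_c \<kappa> ` {1..6} \<union> {rel_d \<kappa>}"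

definition rel_ideal :: "'k::field \<Rightarrow> 'k gpoly set" where
  "rel_ideal \<kappa> = Idl\<^bsub>class_ring\<^esub> (relations \<kappa>)"

definition cls :: "'k::field \<Rightarrow> 'k gpoly \<Rightarrow> 'k gpoly set" where
  "cls \<kappa> p = rel_ideal \<kappa> +>\<^bsub>class_ring\<^esub> p"

definition genus2_alg :: "'k::field \<Rightarrow> ('k, 'k gpoly set) module" where
  "genus2_alg \<kappa> =
     (let Q = class_ring Quot rel_ideal \<kappa> in
      \<lparr>carrier = carrier Q, mult = mult Q, one = one Q, zero = zero Q, add = add Q,
       smult = (\<lambda>c x. cls \<kappa> (const c) \<otimes>\<^bsub>Q\<^esub> x)\<rparr>)"

lemma rel_ideal_ideal: "ideal (rel_ideal \<kappa>) class_ring"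
  unfolding rel_ideal_def
  by (rule ring.genideal_ideal[OF class_ring.ring_axioms]) simp

lemma const_add: "const (a + b) = const a + const b"
  by (simp add: const_def single_add)

lemma const_mult: "const (a * b) = const a * const b"
  by (simp add: const_def mult_single)

lemma const_1: "const 1 = 1"
  by (simp add: const_def)

lemma genus2_alg_algebra: "algebra class_ring (genus2_alg (\<kappa> :: 'k::field))"
proof -
  interpret I: ideal "rel_ideal \<kappa>" "class_ring" by (rule rel_ideal_ideal)
  let ?Q = "(class_ring :: 'k gpoly ring) Quot rel_ideal \<kappa>"
  have "cring (class_ring :: 'k gpoly ring)" by unfold_locales
  then interpret Q: cring ?Q by (rule I.quotient_is_cring)
  interpret h: ring_hom_ring class_ring ?Q "cls \<kappa>"
    unfolding cls_def[abs_def] by (rule I.rcos_ring_hom_ring)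
  have [simp]: "cls \<kappa> p \<in> carrier ?Q" for p using h.hom_closed[of p] by simp
  have add: "cls \<kappa> (p + q) = cls \<kappa> p \<oplus>\<^bsub>?Q\<^esub> cls \<kappa> q" for p q
    using h.hom_add[of p q] by simp
  have mult: "cls \<kappa> (p * q) = cls \<kappa> p \<otimes>\<^bsub>?Q\<^esub> cls \<kappa> q" for p q
    using h.hom_mult[of p q] by simp
  have one: "cls \<kappa> 1 = \<one>\<^bsub>?Q\<^esub>"
    using h.hom_one by simp
  have M: "cring (genus2_alg \<kappa>)"
  proof (intro cringI abelian_groupI comm_monoidI)
    fix x assume "x \<in> carrier (genus2_alg \<kappa>)"
    then show "\<exists>y\<in>carrier (genus2_alg \<kappa>). y \<oplus>\<^bsub>genus2_alg \<kappa>\<^esub> x = \<zero>\<^bsub>genus2_alg \<kappa>\<^esub>"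
      using Q.l_neg[of x] Q.a_inv_closed[of x] by (auto simp: genus2_alg_def Let_def)
  qed (auto simp: genus2_alg_def Let_def Q.a_ac Q.m_ac Q.l_distr Q.r_distr)
  interpret M: cring "genus2_alg \<kappa>" by (rule M)
  show ?thesis
  proof (rule algebraI)
    show "cring (class_ring :: 'k ring)" by unfold_locales
    show "cring (genus2_alg \<kappa>)" by (rule M)
  qed (auto simp: genus2_alg_def Let_def const_add const_mult const_1 add mult one
        Q.l_distr Q.r_distr Q.m_assoc)
qed

lemma genus2_alg_vectorspace: "vectorspace class_ring (genus2_alg (\<kappa> :: 'k::field))"
proof -
  interpret algebra class_ring "genus2_alg \<kappa>" by (rule genus2_alg_algebra)
  show ?thesis by unfold_locales
qed


text \<open>
  Coordinates of \<open>x\<close> with respect to a possibly infinite basis \<open>S\<close>, as a finitely supported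
  coefficient function vanishing off \<open>S\<close>; \<open>coordinates_ex1\<close> shows that the description is
  proper when \<open>S\<close> is a basis.
\<close>

definition (in vectorspace) coordinates :: "'c set \<Rightarrow> 'c \<Rightarrow> 'c \<Rightarrow> 'a" where
  "coordinates S x =
     (THE a. a \<in> UNIV \<rightarrow> carrier K \<and> finite {v. a v \<noteq> \<zero>\<^bsub>K\<^esub>} \<and> {v. a v \<noteq> \<zero>\<^bsub>K\<^esub>} \<subseteq> S \<and>
             lincomb a {v. a v \<noteq> \<zero>\<^bsub>K\<^esub>} = x)"

lemma (in vectorspace) coordinates_ex1:
  assumes S: "basis S" and x: "x \<in> carrier V"
  shows "\<exists>!a. a \<in> UNIV \<rightarrow> carrier K \<and> finite {v. a v \<noteq> \<zero>\<^bsub>K\<^esub>} \<and> {v. a v \<noteq> \<zero>\<^bsub>K\<^esub>} \<subseteq> S \<and>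
             lincomb a {v. a v \<noteq> \<zero>\<^bsub>K\<^esub>} = x"
proof -
  have SV: "S \<subseteq> carrier V" and gen: "span S = carrier V" and ind: "lin_indpt S"
    using S by (auto simp: basis_def)
  have extend: "lincomb a A = lincomb a {v. a v \<noteq> \<zero>\<^bsub>K\<^esub>}"
    if "a \<in> UNIV \<rightarrow> carrier K" "finite A" "A \<subseteq> S" "{v. a v \<noteq> \<zero>\<^bsub>K\<^esub>} \<subseteq> A" for a A
  proof -
    have "A = {v. a v \<noteq> \<zero>\<^bsub>K\<^esub>} \<union> (A - {v. a v \<noteq> \<zero>\<^bsub>K\<^esub>})" using that by auto
    moreover have "lincomb a ({v. a v \<noteq> \<zero>\<^bsub>K\<^esub>} \<union> (A - {v. a v \<noteq> \<zero>\<^bsub>K\<^esub>}))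
        = lincomb a {v. a v \<noteq> \<zero>\<^bsub>K\<^esub>}"
      by (rule lincomb_clean) (use that SV finite_subset[OF that(4,2)] in auto)
    ultimately show ?thesis by simp
  qed
  show ?thesis
  proof (rule ex_ex1I)
    obtain a A where A: "finite A" "A \<subseteq> S" "a \<in> A \<rightarrow> carrier K" "x = lincomb a A"
      using x unfolding gen[symmetric] span_def by blast
    define b where "b v = (if v \<in> A then a v else \<zero>\<^bsub>K\<^esub>)" for v
    have b: "b \<in> UNIV \<rightarrow> carrier K" using A(3) by (auto simp: b_def)
    have sub: "{v. b v \<noteq> \<zero>\<^bsub>K\<^esub>} \<subseteq> A" by (auto simp: b_def)
    have "x = lincomb b A"
      unfolding A(4) by (rule lincomb_restrict) (use A SV in \<open>auto simp: b_def restrict_def\<close>)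
    also have "\<dots> = lincomb b {v. b v \<noteq> \<zero>\<^bsub>K\<^esub>}"
      by (rule extend[OF b A(1,2) sub])
    finally show "\<exists>a. a \<in> UNIV \<rightarrow> carrier K \<and> finite {v. a v \<noteq> \<zero>\<^bsub>K\<^esub>} \<and> {v. a v \<noteq> \<zero>\<^bsub>K\<^esub>} \<subseteq> S \<and>
             lincomb a {v. a v \<noteq> \<zero>\<^bsub>K\<^esub>} = x"
      using b sub A(1,2) by (intro exI[of _ b]) (auto intro: finite_subset)
  next
    fix a b
    assume "a \<in> UNIV \<rightarrow> carrier K \<and> finite {v. a v \<noteq> \<zero>\<^bsub>K\<^esub>} \<and> {v. a v \<noteq> \<zero>\<^bsub>K\<^esub>} \<subseteq> S \<and>
             lincomb a {v. a v \<noteq> \<zero>\<^bsub>K\<^esub>} = x"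
      and "b \<in> UNIV \<rightarrow> carrier K \<and> finite {v. b v \<noteq> \<zero>\<^bsub>K\<^esub>} \<and> {v. b v \<noteq> \<zero>\<^bsub>K\<^esub>} \<subseteq> S \<and>
             lincomb b {v. b v \<noteq> \<zero>\<^bsub>K\<^esub>} = x"
    then have a: "a \<in> UNIV \<rightarrow> carrier K" "finite {v. a v \<noteq> \<zero>\<^bsub>K\<^esub>}" "{v. a v \<noteq> \<zero>\<^bsub>K\<^esub>} \<subseteq> S"
        "lincomb a {v. a v \<noteq> \<zero>\<^bsub>K\<^esub>} = x"
      and b: "b \<in> UNIV \<rightarrow> carrier K" "finite {v. b v \<noteq> \<zero>\<^bsub>K\<^esub>}" "{v. b v \<noteq> \<zero>\<^bsub>K\<^esub>} \<subseteq> S"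
        "lincomb b {v. b v \<noteq> \<zero>\<^bsub>K\<^esub>} = x" by auto
    define T where "T = {v. a v \<noteq> \<zero>\<^bsub>K\<^esub>} \<union> {v. b v \<noteq> \<zero>\<^bsub>K\<^esub>}"
    have T: "finite T" "T \<subseteq> S" using a b by (auto simp: T_def)
    have aT: "lincomb a T = x" using extend[OF a(1) T] a by (auto simp: T_def)
    have bT: "lincomb b T = x" using extend[OF b(1) T] b by (auto simp: T_def)
    have ac: "a v \<in> carrier K" and bc: "b v \<in> carrier K" for v using a(1) b(1) by auto
    have vc: "v \<in> carrier V" if "v \<in> T" for v using that T SV by auto
    let ?c = "\<lambda>v. a v \<oplus>\<^bsub>K\<^esub> (\<ominus>\<^bsub>K\<^esub> \<one>\<^bsub>K\<^esub>) \<otimes>\<^bsub>K\<^esub> b v"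
    have "lincomb ?c T = lincomb a T \<oplus>\<^bsub>V\<^esub> lincomb (\<lambda>v. (\<ominus>\<^bsub>K\<^esub> \<one>\<^bsub>K\<^esub>) \<otimes>\<^bsub>K\<^esub> b v) T"
    proof -
      have "lincomb ?c T =
          (\<Oplus>\<^bsub>V\<^esub>v\<in>T. a v \<odot>\<^bsub>V\<^esub> v \<oplus>\<^bsub>V\<^esub> ((\<ominus>\<^bsub>K\<^esub> \<one>\<^bsub>K\<^esub>) \<otimes>\<^bsub>K\<^esub> b v) \<odot>\<^bsub>V\<^esub> v)"
        unfolding lincomb_def
        by (rule M.finsum_cong') (use ac bc vc in \<open>auto intro!: smult_l_distr\<close>)
      also have "\<dots> = lincomb a T \<oplus>\<^bsub>V\<^esub> lincomb (\<lambda>v. (\<ominus>\<^bsub>K\<^esub> \<one>\<^bsub>K\<^esub>) \<otimes>\<^bsub>K\<^esub> b v) T"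
        unfolding lincomb_def
        by (rule M.finsum_addf) (use ac bc vc in auto)
      finally show ?thesis .
    qed
    also have "\<dots> = x \<oplus>\<^bsub>V\<^esub> (\<ominus>\<^bsub>K\<^esub> \<one>\<^bsub>K\<^esub>) \<odot>\<^bsub>V\<^esub> x"
    proof -
      have "T \<subseteq> carrier V" "b \<in> T \<rightarrow> carrier K" using vc bc by auto
      then show ?thesis
        using lincomb_smult[of T b "\<ominus>\<^bsub>K\<^esub> \<one>\<^bsub>K\<^esub>"] aT bT by simp
    qed
    also have "\<dots> = \<zero>\<^bsub>V\<^esub>"
      using x by (simp add: smult_minus_1 M.r_neg)
    finally have c0: "?c \<in> T \<rightarrow> {\<zero>\<^bsub>K\<^esub>}"
      using not_lindepD[OF ind T, of ?c] ac bc by auto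
    show "a = b"
    proof
      fix v
      show "a v = b v"
      proof (cases "v \<in> T")
        case True
        then have "a v \<ominus>\<^bsub>K\<^esub> b v = \<zero>\<^bsub>K\<^esub>"
          using c0 ac bc by (auto simp: R.l_minus a_minus_def)
        then show ?thesis using ac bc by simp
      qed (auto simp: T_def)
    qed
  qed
qed

definition structure_constant ::
    "'k::field \<Rightarrow> monomial set \<Rightarrow> monomial \<Rightarrow> monomial \<Rightarrow> monomial \<Rightarrow> 'k" where
  "structure_constant \<kappa> B m1 m2 m =
     vectorspace.coordinates class_ring (genus2_alg \<kappa>) ((\<lambda>b. cls \<kappa> (mono_poly b)) ` B)
       (cls \<kappa> (mono_poly m1) \<otimes>\<^bsub>genus2_alg \<kappa>\<^esub> cls \<kappa> (mono_poly m2)) (cls \<kappa> (mono_poly m))"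

text \<open>
  Injectivity is part of the notion: the basis is the family of images indexed by \<open>B\<close>.
\<close>

definition monomial_basis :: "'k::field \<Rightarrow> monomial set \<Rightarrow> bool" where
  "monomial_basis \<kappa> B \<longleftrightarrow>
     inj_on (\<lambda>b. cls \<kappa> (mono_poly b)) B \<and>
     vectorspace.basis class_ring (genus2_alg \<kappa>) ((\<lambda>b. cls \<kappa> (mono_poly b)) ` B)"


text \<open>
  The field $\mathbb{C}(t^{1/4})$ is the field of rational functions in one variable, \<open>t4\<close>,
  which plays the role of $t^{1/4}$.
\<close>

definition t4 :: "complex poly fract" where
  "t4 = Fract [:0, 1:] 1"

definition kappa_t :: "complex poly fract" where
  "kappa_t = t4^2 + inverse (t4^2)"

text \<open>
  \<open>laurent\<close> is the subring $\mathbb{C}[t^{\pm 1/4}]$, and \<open>specialize_1\<close> is the evaluation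
  $t^{1/4} \mapsto 1$ on it; the value is independent of the fraction chosen, by
  \<open>specialize_1_Fract\<close>.
\<close>

definition laurent :: "complex poly fract set" where
  "laurent = {Fract p (Polynomial.monom 1 n) | p n. True}"

definition specialize_1 :: "complex poly fract \<Rightarrow> complex" where
  "specialize_1 x = (THE c. \<exists>p n. x = Fract p (Polynomial.monom 1 n) \<and> c = poly p 1)"

lemma specialize_1_Fract: "specialize_1 (Fract p (Polynomial.monom 1 n)) = poly p 1"
  unfolding specialize_1_def
proof (rule the_equality)
  fix c assume "\<exists>q m. Fract p (Polynomial.monom 1 n) = Fract q (Polynomial.monom 1 m) \<and> c = poly q 1"
  then obtain q m where *: "Fract p (Polynomial.monom 1 n) = Fract q (Polynomial.monom 1 m)"
    and c: "c = poly q 1" by blast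
  from * have "p * Polynomial.monom 1 m = q * Polynomial.monom 1 n"
    by (simp add: eq_fract monom_eq_0_iff)
  then have "poly (p * Polynomial.monom 1 m) 1 = poly (q * Polynomial.monom 1 n) 1" by simp
  then show "c = poly p 1" by (simp add: c poly_monom)
qed blast

lemma specialize_1_kappa_t: "kappa_t \<in> laurent" "specialize_1 kappa_t = 2"
proof -
  have "kappa_t = Fract (1 + Polynomial.monom 1 4) (Polynomial.monom 1 2)"
    by (simp add: kappa_t_def t4_def power2_eq_square monom_altdef eval_nat_numeral add.commute)
  note eq = this
  show "kappa_t \<in> laurent" unfolding eq laurent_def by blast
  show "specialize_1 kappa_t = 2" unfolding eq specialize_1_Fract by (simp add: poly_monom)
qed

end

theory Submission
  imports Defs
begin

text \<open>
  The ideal of relations has a Groebner basis that does not depend on the field of coefficients: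
  52 polynomials with coefficients in \<open>\<int>[\<kappa>]\<close> and leading coefficient 1, which generate the ideal
  and satisfy Buchberger's criterion over every field in which \<open>\<kappa>\<close> and 2 are units. For \<open>B\<close> one
  takes the set \<open>normal_monomials\<close> of the monomials divisible by none of the 52 leading monomials.

  The classes of \<open>B\<close> span the quotient because a leading monomial can be replaced by its lighter
  tail until none is left. They are independent because an element of the ideal all of whose
  monomials lie in \<open>B\<close> vanishes (\<open>irreducible_rel_ideal_0\<close>). Because the leading coefficients are
  1, this rewriting never divides. The normal form of a product of two elements of \<open>B\<close> therefore
  has coefficients in \<open>\<int>[\<kappa>]\<close>, and they are the same polynomials in \<open>\<kappa>\<close> for all fields
  (\<open>joint_normal_form_monomial\<close>). For \<open>\<kappa> = t\<^sup>1\<^sup>/\<^sup>2 + t\<^sup>-\<^sup>1\<^sup>/\<^sup>2\<close> they are Laurent polynomials in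
  \<open>t\<^sup>1\<^sup>/\<^sup>4\<close>, and \<open>t\<^sup>1\<^sup>/\<^sup>4 = 1\<close> turns them into their values at \<open>\<kappa> = 2\<close>.

  Three finite computations with lists of terms over \<open>\<int>[\<kappa>]\<close> carry the proof: each basis element
  is derived from the relations (\<open>derived_rules\<close>), each relation reduces to 0 modulo the basis
  (\<open>relations_reduce\<close>), and each S-polynomial does so as well or is dispensed with by one of
  Buchberger's two criteria (\<open>pairs_rules\<close>). Being computations over \<open>\<int>[\<kappa>]\<close>, they need to be done
  only once; \<open>val\<close> transports them to all fields.
\<close>

section \<open>Weights of monomials\<close>

text \<open>
  The weights are chosen so that every element of the Groebner basis has a single heaviest
  monomial. Weight then replaces a monomial order, and well-foundedness and compatibility with
  multiplication come for free.
\<close>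

fun gen_weight :: "gen \<Rightarrow> nat" where
  "gen_weight O1 = 19" | "gen_weight O2 = 27" | "gen_weight O3 = 24"
| "gen_weight O4 = 17" | "gen_weight O5 = 16" | "gen_weight O6 = 20"
| "gen_weight O12 = 35" | "gen_weight O23 = 32" | "gen_weight O34 = 27"
| "gen_weight O45 = 22" | "gen_weight O56 = 32" | "gen_weight O61 = 21"
| "gen_weight O123 = 34" | "gen_weight O234 = 31" | "gen_weight O345 = 30"

definition weight :: "monomial \<Rightarrow> nat" where
  "weight m = (\<Sum>g\<in>UNIV. gen_weight g * Poly_Mapping.lookup m g)"

lemma finite_UNIV_gen: "finite (UNIV :: gen set)"
proof -
  have "(UNIV :: gen set) \<subseteq> {O1, O2, O3, O4, O5, O6, O12, O23, O34, O45, O56, O61, O123, O234, O345}"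
    (is "_ \<subseteq> ?S")
  proof
    fix g :: gen
    show "g \<in> ?S" by (cases g) auto
  qed
  then show ?thesis by (rule finite_subset) simp
qed

lemma weight_0 [simp]: "weight 0 = 0"
  by (simp add: weight_def)

lemma weight_add: "weight (m + n) = weight m + weight n"
  by (simp add: weight_def lookup_add distrib_left sum.distrib)

lemma weight_single: "weight (Poly_Mapping.single g 1) = gen_weight g"
proof -
  have "weight (Poly_Mapping.single g 1) = (\<Sum>h\<in>UNIV. if h = g then gen_weight g else 0)"
    unfolding weight_def by (intro sum.cong) (auto simp: lookup_single when_def)
  then show ?thesis by (simp add: finite_UNIV_gen)
qed


section \<open>Term lists\<close>

text \<open>
  A monomial is written as a word in the generators. Words and the terms built from them are
  concrete data, on which the simplifier can calculate.
\<close>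

fun monom_of :: "gen list \<Rightarrow> monomial" where
  "monom_of [] = 0"
| "monom_of (g # u) = Poly_Mapping.single g 1 + monom_of u"

fun word_weight :: "gen list \<Rightarrow> nat" where
  "word_weight [] = 0"
| "word_weight (g # u) = gen_weight g + word_weight u"

lemma weight_monom_of: "weight (monom_of u) = word_weight u"
  by (induction u) (auto simp: weight_add weight_single[simplified])

lemma lookup_monom_of: "Poly_Mapping.lookup (monom_of u) g = count_list u g"
  by (induction u) (auto simp: lookup_add lookup_single when_def)

lemma monom_of_append: "monom_of (u @ v) = monom_of u + monom_of v"
  by (induction u) (auto simp: add_ac)

lemma ex_word: "\<exists>u. m = monom_of u"
proof (induction m rule: update_induct)
  case const
  show ?case by (rule exI[of _ "[]"]) simp
next
  case (update f g n)
  then obtain u where u: "f = monom_of u" by auto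
  have "Poly_Mapping.lookup (monom_of (replicate n g)) = Poly_Mapping.lookup (Poly_Mapping.single g n)"
    by (induction n) (auto simp: lookup_add lookup_single when_def)
  then have "monom_of (replicate n g) = Poly_Mapping.single g n"
    by (simp add: poly_mapping_eqI)
  moreover have "Poly_Mapping.update g n f = Poly_Mapping.single g n + f"
    using update by (intro poly_mapping_eqI)
      (auto simp: lookup_update lookup_add lookup_single when_def in_keys_iff)
  ultimately show ?case
    by (intro exI[of _ "replicate n g @ u"]) (simp add: monom_of_append u)
qed

text \<open>
  A term is an integer times a power of \<open>\<kappa>\<close> times a word. The stored weight is meant to be that of
  the word: with it, comparing two terms is in most cases comparing two numbers.
\<close>

datatype trm = Trm (trm_weight: nat) (trm_word: "gen list") (trm_exp: nat) (trm_coeff: int)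

definition tm :: "int \<Rightarrow> nat \<Rightarrow> gen list \<Rightarrow> trm" where
  "tm c k u = Trm (word_weight u) u k c"

definition trm_val :: "'k::field \<Rightarrow> trm \<Rightarrow> 'k gpoly" where
  "trm_val \<kappa> t =
     Poly_Mapping.single (monom_of (trm_word t)) (of_int (trm_coeff t) * \<kappa> ^ trm_exp t)"

definition val :: "'k::field \<Rightarrow> trm list \<Rightarrow> 'k gpoly" where
  "val \<kappa> p = sum_list (map (trm_val \<kappa>) p)"

lemma val_simps [simp]:
  "val \<kappa> [] = 0"
  "val \<kappa> (t # p) = trm_val \<kappa> t + val \<kappa> p"
  by (simp_all add: val_def)

lemma val_append: "val \<kappa> (p @ q) = val \<kappa> p + val \<kappa> q"
  by (induction p) (auto simp: add_ac)

definition words_below :: "nat \<Rightarrow> trm list \<Rightarrow> bool" where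
  "words_below n p \<longleftrightarrow> (\<forall>t\<in>set p. word_weight (trm_word t) < n)"

lemma ex_words_below: "\<exists>n. words_below n p"
  unfolding words_below_def
  by (rule exI[of _ "Suc (Max (insert 0 ((\<lambda>t. word_weight (trm_word t)) ` set p)))"])
    (auto simp: less_Suc_eq_le)

datatype cmp = LT | EQ | GT

definition cmp :: "'a::linorder \<Rightarrow> 'a \<Rightarrow> cmp" where
  "cmp a b = (if a < b then LT else if b < a then GT else EQ)"

fun rank :: "gen \<Rightarrow> int" where
  "rank O1 = 1" | "rank O2 = 2" | "rank O3 = 3" | "rank O4 = 4" | "rank O5 = 5" | "rank O6 = 6"
| "rank O12 = 7" | "rank O23 = 8" | "rank O34 = 9" | "rank O45 = 10" | "rank O56 = 11"
| "rank O61 = 12" | "rank O123 = 13" | "rank O234 = 14" | "rank O345 = 15"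

definition cmp_gen :: "gen \<Rightarrow> gen \<Rightarrow> cmp" where
  "cmp_gen g h = cmp (rank g) (rank h)"

lemma rank_inj: "rank g = rank h \<Longrightarrow> g = h"
  by (cases g; cases h) simp_all

lemma cmp_EQ: "cmp a b = EQ \<longleftrightarrow> a = b"
  by (auto simp: cmp_def)

lemma cmp_gen_EQ: "cmp_gen g h = EQ \<longleftrightarrow> g = h"
  by (auto simp: cmp_gen_def cmp_EQ dest: rank_inj)

text \<open>
  On words of increasing rank the empty word is the largest, which makes the comparison
  compatible with multiplication.
\<close>

fun cmp_word :: "gen list \<Rightarrow> gen list \<Rightarrow> cmp" where
  "cmp_word [] [] = EQ"
| "cmp_word [] (h # v) = GT"
| "cmp_word (g # u) [] = LT"
| "cmp_word (g # u) (h # v) = (case cmp_gen g h of LT \<Rightarrow> LT | GT \<Rightarrow> GT | EQ \<Rightarrow> cmp_word u v)"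

lemma cmp_word_EQ: "cmp_word u v = EQ \<Longrightarrow> u = v"
  by (induction u v rule: cmp_word.induct) (auto split: cmp.splits simp: cmp_gen_EQ)

fun cmp_trm :: "trm \<Rightarrow> trm \<Rightarrow> cmp" where
  "cmp_trm (Trm w u k c) (Trm w' u' k' c') =
     (case cmp w w' of LT \<Rightarrow> LT | GT \<Rightarrow> GT
      | EQ \<Rightarrow> (case cmp_word u u' of LT \<Rightarrow> LT | GT \<Rightarrow> GT | EQ \<Rightarrow> cmp k k'))"

lemma cmp_trm_EQ:
  "cmp_trm s t = EQ \<Longrightarrow> trm_word s = trm_word t \<and> trm_exp s = trm_exp t"
  by (cases s; cases t) (auto split: cmp.splits simp: cmp_EQ dest: cmp_word_EQ)

definition cons_sum :: "trm \<Rightarrow> trm \<Rightarrow> trm list \<Rightarrow> trm list" where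
  "cons_sum s t p =
     (if trm_coeff s + trm_coeff t = 0 then p
      else Trm (trm_weight s) (trm_word s) (trm_exp s) (trm_coeff s + trm_coeff t) # p)"

text \<open>
  Term lists are kept in descending order, so that the head of a list is its heaviest term.
\<close>

fun add_terms :: "trm list \<Rightarrow> trm list \<Rightarrow> trm list" where
  "add_terms [] q = q"
| "add_terms (s # p) [] = s # p"
| "add_terms (s # p) (t # q) =
     (case cmp_trm s t of
        GT \<Rightarrow> s # add_terms p (t # q) | LT \<Rightarrow> t # add_terms (s # p) q | EQ \<Rightarrow> cons_sum s t (add_terms p q))"

lemma val_cons_sum:
  assumes "cmp_trm s t = EQ"
  shows "val \<kappa> (cons_sum s t p) = trm_val \<kappa> s + trm_val \<kappa> t + val \<kappa> p"
proof -
  have "trm_val \<kappa> s + trm_val \<kappa> t = Poly_Mapping.single (monom_of (trm_word s))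
      (of_int (trm_coeff s + trm_coeff t) * \<kappa> ^ trm_exp s)"
    using cmp_trm_EQ[OF assms] by (simp add: trm_val_def distrib_right single_add)
  then show ?thesis
    by (cases "trm_coeff s + trm_coeff t = 0") (simp_all add: cons_sum_def trm_val_def del: of_int_add)
qed

lemma val_add_terms: "val \<kappa> (add_terms p q) = val \<kappa> p + val \<kappa> q"
  by (induction p q rule: add_terms.induct) (auto split: cmp.splits simp: val_cons_sum add_ac)

lemma set_add_terms: "t \<in> set (add_terms p q) \<Longrightarrow> trm_word t \<in> trm_word ` (set p \<union> set q)"
  by (induction p q rule: add_terms.induct) (auto split: cmp.splits if_splits simp: cons_sum_def)

lemma words_below_add_terms: "words_below n p \<Longrightarrow> words_below n q \<Longrightarrow> words_below n (add_terms p q)"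
  unfolding words_below_def by (fastforce dest: set_add_terms)

fun mult_word :: "gen list \<Rightarrow> gen list \<Rightarrow> gen list" where
  "mult_word [] v = v"
| "mult_word (g # u) [] = g # u"
| "mult_word (g # u) (h # v) =
     (case cmp_gen g h of
        GT \<Rightarrow> h # mult_word (g # u) v | LT \<Rightarrow> g # mult_word u (h # v)
      | EQ \<Rightarrow> g # mult_word u (h # v))"

lemma monom_of_mult_word: "monom_of (mult_word u v) = monom_of u + monom_of v"
  by (induction u v rule: mult_word.induct) (auto split: cmp.splits simp: add_ac)

lemma word_weight_mult_word: "word_weight (mult_word u v) = word_weight u + word_weight v"
  by (simp add: weight_monom_of[symmetric] monom_of_mult_word weight_add)

fun mult_trm :: "trm \<Rightarrow> trm \<Rightarrow> trm" where
  "mult_trm (Trm w u k c) (Trm w' u' k' c') = Trm (w + w') (mult_word u u') (k + k') (c * c')"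

fun scale :: "trm \<Rightarrow> trm list \<Rightarrow> trm list" where
  "scale t [] = []"
| "scale t (s # p) = mult_trm t s # scale t p"

lemma trm_val_mult_trm: "trm_val \<kappa> (mult_trm s t) = trm_val \<kappa> s * trm_val \<kappa> t"
  by (cases s; cases t) (simp add: trm_val_def mult_single monom_of_mult_word power_add mult_ac)

lemma val_scale: "val \<kappa> (scale t p) = trm_val \<kappa> t * val \<kappa> p"
  by (induction p) (auto simp: trm_val_mult_trm distrib_left)

lemma word_weight_mult_trm:
  "word_weight (trm_word (mult_trm s t)) = word_weight (trm_word s) + word_weight (trm_word t)"
  by (cases s; cases t) (simp add: word_weight_mult_word)

lemma words_below_scale:
  "words_below n p \<Longrightarrow> words_below (word_weight (trm_word t) + n) (scale t p)"
  by (induction p) (auto simp: words_below_def word_weight_mult_trm)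

fun quot :: "gen list \<Rightarrow> gen list \<Rightarrow> gen list option" where
  "quot u [] = Some u"
| "quot [] (h # v) = None"
| "quot (g # u) (h # v) =
     (case cmp_gen g h of
        GT \<Rightarrow> None | LT \<Rightarrow> map_option (Cons g) (quot u (h # v)) | EQ \<Rightarrow> quot u v)"

lemma quot_Some: "quot u v = Some a \<Longrightarrow> monom_of u = monom_of a + monom_of v"
  by (induction u v arbitrary: a rule: quot.induct)
    (auto split: cmp.splits simp: cmp_gen_EQ add_ac)

text \<open>
  The cofactor that completes the first word to a least common multiple of both. Deleting
  occurrences one by one gives the right multiplicities for words in any order.
\<close>

fun missing :: "gen list \<Rightarrow> gen list \<Rightarrow> gen list" where
  "missing [] v = v"
| "missing (g # u) v = missing u (remove1 g v)"

lemma lookup_missing: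
  "Poly_Mapping.lookup (monom_of (missing u v)) g =
     Poly_Mapping.lookup (monom_of v) g - Poly_Mapping.lookup (monom_of u) g"
proof -
  have r: "count_list (remove1 h w) g = count_list w g - (if g = h then 1 else 0)" for h and w :: "gen list"
    by (induction w) (auto simp: count_list_0_iff)
  show ?thesis
    unfolding lookup_monom_of by (induction u arbitrary: v) (auto simp: r)
qed


section \<open>Rewriting rules and the weight filtration\<close>

lemma update_eq_add:
  assumes "m \<notin> Poly_Mapping.keys f"
  shows "Poly_Mapping.update m c f = f + Poly_Mapping.single m c"
  using assms by (intro poly_mapping_eqI)
    (auto simp: lookup_update lookup_add lookup_single when_def in_keys_iff)

type_synonym rule = "gen list \<times> trm list"

text \<open>
  A rule replaces its leading word by a combination of terms; as a polynomial it is the difference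
  of the two sides, so its leading coefficient is 1.
\<close>

definition rule_poly :: "'k::field \<Rightarrow> rule \<Rightarrow> 'k gpoly" where
  "rule_poly \<kappa> \<rho> = Poly_Mapping.single (monom_of (fst \<rho>)) 1 - val \<kappa> (snd \<rho>)"

definition decreasing :: "rule list \<Rightarrow> bool" where
  "decreasing G \<longleftrightarrow> (\<forall>\<rho>\<in>set G. words_below (word_weight (fst \<rho>)) (snd \<rho>))"

text \<open>
  The combinations of multiples of rules whose leading monomials all weigh less than \<open>n\<close>. This
  filtration of the ideal generated by the rules records how much cancellation a presentation of an
  element as such a combination involves; the union over all \<open>n\<close> is the whole ideal.
\<close>

inductive_set below :: "'k::field \<Rightarrow> rule list \<Rightarrow> nat \<Rightarrow> 'k gpoly set"
  for \<kappa> :: "'k::field" and G n where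
  zero: "0 \<in> below \<kappa> G n"
| step: "\<lbrakk>f \<in> below \<kappa> G n; \<rho> \<in> set G; weight (a + monom_of (fst \<rho>)) < n\<rbrakk>
    \<Longrightarrow> f + Poly_Mapping.single a c * rule_poly \<kappa> \<rho> \<in> below \<kappa> G n"

lemma below_rule:
  "\<rho> \<in> set G \<Longrightarrow> weight (a + monom_of (fst \<rho>)) < n
    \<Longrightarrow> Poly_Mapping.single a c * rule_poly \<kappa> \<rho> \<in> below \<kappa> G n"
  using below.step[OF below.zero] by simp

lemma below_mono: "f \<in> below \<kappa> G m \<Longrightarrow> m \<le> n \<Longrightarrow> f \<in> below \<kappa> G n"
  by (induction rule: below.induct) (auto intro: below.intros)

lemma below_add:
  assumes "f \<in> below \<kappa> G n" "g \<in> below \<kappa> G n"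
  shows "f + g \<in> below \<kappa> G n"
  using assms(2)
proof induction
  case zero
  then show ?case using assms(1) by simp
next
  case (step g \<rho> a c)
  then show ?case by (simp add: add.assoc[symmetric] below.step)
qed

lemma below_single_mult:
  assumes "f \<in> below \<kappa> G n"
  shows "Poly_Mapping.single b d * f \<in> below \<kappa> G (weight b + n)"
  using assms
proof induction
  case zero
  then show ?case by (simp add: below.zero)
next
  case (step f \<rho> a c)
  have "Poly_Mapping.single b d * (f + Poly_Mapping.single a c * rule_poly \<kappa> \<rho>)
      = Poly_Mapping.single b d * f + Poly_Mapping.single (b + a) (d * c) * rule_poly \<kappa> \<rho>"
    by (simp add: distrib_left mult.assoc[symmetric] mult_single)
  moreover have "weight ((b + a) + monom_of (fst \<rho>)) < weight b + n"
    using step.hyps by (simp add: weight_add add.assoc)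
  ultimately show ?case using step by (simp add: below.step)
qed

lemma below_single_0_mult: "f \<in> below \<kappa> G n \<Longrightarrow> Poly_Mapping.single 0 d * f \<in> below \<kappa> G n"
  using below_single_mult[of f \<kappa> G n 0 d] by simp

lemma below_uminus: "f \<in> below \<kappa> G n \<Longrightarrow> - f \<in> below \<kappa> G n"
  using below_single_0_mult[of f \<kappa> G n "- 1"] by (simp add: single_uminus)

lemma below_diff: "f \<in> below \<kappa> G n \<Longrightarrow> g \<in> below \<kappa> G n \<Longrightarrow> f - g \<in> below \<kappa> G n"
  using below_add[of f \<kappa> G n "- g"] below_uminus[of g] by simp

lemma keys_val_weight:
  assumes "words_below n p" "m \<in> Poly_Mapping.keys (val \<kappa> p)"
  shows "weight m < n"
  using assms
proof (induction p)
  case (Cons t p)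
  have "m \<in> Poly_Mapping.keys (trm_val \<kappa> t) \<or> m \<in> Poly_Mapping.keys (val \<kappa> p)"
    using Cons.prems(2) keys_add[of "trm_val \<kappa> t" "val \<kappa> p"] by auto
  moreover have "weight m < n" if "m \<in> Poly_Mapping.keys (trm_val \<kappa> t)"
  proof -
    have "m = monom_of (trm_word t)"
      using that by (auto simp: trm_val_def split: if_splits)
    then show ?thesis using Cons.prems(1) by (simp add: words_below_def weight_monom_of)
  qed
  ultimately show ?case using Cons by (auto simp: words_below_def)
qed simp

lemma lookup_single_mult:
  fixes f :: "'k::field gpoly"
  shows "Poly_Mapping.lookup (Poly_Mapping.single a c * f) m =
     (if \<exists>b. m = a + b then c * Poly_Mapping.lookup f (m - a) else 0)"
proof -
  have "Poly_Mapping.lookup (Poly_Mapping.single a c * f) m =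
      c * (\<Sum>q. Poly_Mapping.lookup f q when m = a + q)"
    by (simp add: lookup_mult lookup_single when_mult)
  also have "\<dots> = (if \<exists>b. m = a + b then c * Poly_Mapping.lookup f (m - a) else 0)"
  proof (cases "\<exists>b. m = a + b")
    case True
    then obtain b where b: "m = a + b" by auto
    have "(\<lambda>q. Poly_Mapping.lookup f q when m = a + q) = (\<lambda>q. Poly_Mapping.lookup f q when q = b)"
      by (auto simp: b fun_eq_iff when_def)
    then show ?thesis using b by simp
  qed (auto simp: when_def)
  finally show ?thesis .
qed

lemma keys_rule_poly:
  assumes "decreasing G" "\<rho> \<in> set G" "m \<in> Poly_Mapping.keys (rule_poly \<kappa> \<rho>)" "m \<noteq> monom_of (fst \<rho>)"
  shows "weight m < weight (monom_of (fst \<rho>))"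
proof -
  have "m \<in> Poly_Mapping.keys (val \<kappa> (snd \<rho>))"
    using assms(3,4) by (auto simp: rule_poly_def in_keys_iff lookup_minus lookup_single when_def)
  then show ?thesis
    using assms(1,2) keys_val_weight unfolding decreasing_def weight_monom_of by blast
qed

lemma lookup_rule_poly_top:
  assumes "decreasing G" "\<rho> \<in> set G"
  shows "Poly_Mapping.lookup (rule_poly \<kappa> \<rho>) (monom_of (fst \<rho>)) = 1"
proof -
  have "monom_of (fst \<rho>) \<notin> Poly_Mapping.keys (val \<kappa> (snd \<rho>))"
    using assms keys_val_weight unfolding decreasing_def
    by (metis less_irrefl weight_monom_of)
  then show ?thesis by (simp add: rule_poly_def lookup_minus in_keys_iff)
qed

text \<open>
  All terms of a rule other than the leading one are lighter, so at the weight of the leading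
  monomial, and above it, nothing else is visible.
\<close>

lemma lookup_shifted_rule:
  assumes "decreasing G" "\<rho> \<in> set G" "weight (a + monom_of (fst \<rho>)) \<le> weight m"
  shows "Poly_Mapping.lookup (Poly_Mapping.single a c * rule_poly \<kappa> \<rho>) m =
    (if m = a + monom_of (fst \<rho>) then c else 0)"
proof (cases "m = a + monom_of (fst \<rho>)")
  case True
  then show ?thesis
    using lookup_rule_poly_top[OF assms(1,2)] by (auto simp: lookup_single_mult)
next
  case False
  have "Poly_Mapping.lookup (rule_poly \<kappa> \<rho>) (m - a) = 0" if "m = a + b" for b
  proof (rule ccontr)
    assume "Poly_Mapping.lookup (rule_poly \<kappa> \<rho>) (m - a) \<noteq> 0"
    then have "b \<in> Poly_Mapping.keys (rule_poly \<kappa> \<rho>)" using that by (simp add: in_keys_iff)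
    then have "weight b < weight (monom_of (fst \<rho>))"
      using keys_rule_poly[OF assms(1,2), of b] False that by auto
    then show False using assms(3) that by (simp add: weight_add)
  qed
  then show ?thesis using False by (auto simp: lookup_single_mult)
qed

lemma lookup_below:
  assumes "decreasing G" "f \<in> below \<kappa> G n" "n \<le> weight m"
  shows "Poly_Mapping.lookup f m = 0"
  using assms(2)
proof induction
  case (step f \<rho> a c)
  then show ?case
    using lookup_shifted_rule[OF assms(1), of \<rho> a m c \<kappa>] assms(3)
    by (auto simp: lookup_add)
qed simp

text \<open>
  The condition on S-polynomials, imposed at all common multiples of the two leading monomials
  instead of the least one only. In this form it is transitive among the rules that divide a given
  monomial, which is what Buchberger's chain criterion exploits.
\<close>

definition linked :: "'k::field \<Rightarrow> rule list \<Rightarrow> rule \<Rightarrow> rule \<Rightarrow> bool" where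
  "linked \<kappa> G \<rho> \<sigma> \<longleftrightarrow>
     (\<forall>a b. a + monom_of (fst \<rho>) = b + monom_of (fst \<sigma>) \<longrightarrow>
        Poly_Mapping.single a 1 * rule_poly \<kappa> \<rho> - Poly_Mapping.single b 1 * rule_poly \<kappa> \<sigma>
          \<in> below \<kappa> G (weight (a + monom_of (fst \<rho>))))"

definition reducible :: "rule list \<Rightarrow> monomial \<Rightarrow> bool" where
  "reducible G m \<longleftrightarrow> (\<exists>\<rho>\<in>set G. \<exists>a. m = a + monom_of (fst \<rho>))"

text \<open>
  For each reducible monomial of weight \<open>n\<close> one multiple of a rule with this leading monomial is
  singled out. Linked rules allow every other multiple to be replaced by it, at the cost of lower
  elements. In the resulting presentation distinct summands of weight \<open>n\<close> have distinct leading
  monomials, so they cannot cancel: their coefficients are coefficients of \<open>f\<close> at reducible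
  monomials, hence 0.
\<close>

lemma below_Suc_lower:
  fixes f :: "'k::field gpoly"
  assumes dec: "decreasing G" and link: "\<And>\<rho> \<sigma>. \<rho> \<in> set G \<Longrightarrow> \<sigma> \<in> set G \<Longrightarrow> linked \<kappa> G \<rho> \<sigma>"
    and f: "f \<in> below \<kappa> G (Suc n)"
    and irred: "\<And>m. m \<in> Poly_Mapping.keys f \<Longrightarrow> \<not> reducible G m"
  shows "f \<in> below \<kappa> G n"
proof -
  have "\<forall>m. \<exists>x. reducible G m \<longrightarrow> fst x \<in> set G \<and> m = snd x + monom_of (fst (fst x))"
    unfolding reducible_def by force
  then obtain x where x: "\<And>m. reducible G m \<Longrightarrow> fst (x m) \<in> set G \<and> m = snd (x m) + monom_of (fst (fst (x m)))"
    by metis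
  define rep shift where "rep m = fst (x m)" and "shift m = snd (x m)" for m
  have rep: "rep m \<in> set G \<and> m = shift m + monom_of (fst (rep m))" if "reducible G m" for m
    using x[OF that] by (simp add: rep_def shift_def)
  define p where "p m = Poly_Mapping.single (shift m) 1 * rule_poly \<kappa> (rep m)" for m
  define top where "top F c = (\<Sum>m\<in>F. Poly_Mapping.single 0 (c m) * p m)" for F and c :: "monomial \<Rightarrow> 'k"
  have "\<exists>F c. finite F \<and> (\<forall>m\<in>F. reducible G m \<and> weight m = n) \<and> f - top F c \<in> below \<kappa> G n"
    using f
  proof induction
    case zero
    show ?case by (intro exI[of _ "{}"]) (auto simp: top_def below.zero)
  next
    case (step f \<rho> a d)
    then obtain F c where F: "finite F" "\<forall>m\<in>F. reducible G m \<and> weight m = n"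
      "f - top F c \<in> below \<kappa> G n" by auto
    let ?m = "a + monom_of (fst \<rho>)"
    let ?g = "Poly_Mapping.single a d * rule_poly \<kappa> \<rho>"
    show ?case
    proof (cases "weight ?m < n")
      case True
      then have "f - top F c + ?g \<in> below \<kappa> G n"
        using F step by (intro below.step) auto
      then show ?thesis using F by (intro exI[of _ F] exI[of _ c]) (auto simp: algebra_simps)
    next
      case False
      have m: "reducible G ?m" "weight ?m = n"
        using step False by (auto simp: reducible_def)
      define c' where "c' = c(?m := d + (if ?m \<in> F then c ?m else 0))"
      have "top (insert ?m F) c' = top F c + Poly_Mapping.single 0 d * p ?m"
      proof -
        have "top (insert ?m F) c' = Poly_Mapping.single 0 (c' ?m) * p ?m + top (F - {?m}) c'"
          unfolding top_def by (rule sum.insert_remove[OF F(1)])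
        moreover have "top (F - {?m}) c' = top (F - {?m}) c"
          unfolding top_def c'_def by (intro sum.cong) auto
        moreover have "top F c = (if ?m \<in> F then Poly_Mapping.single 0 (c ?m) * p ?m else 0) + top (F - {?m}) c"
          using sum.remove[OF F(1), of ?m "\<lambda>m. Poly_Mapping.single 0 (c m) * p m"]
          by (auto simp: top_def)
        ultimately show ?thesis by (auto simp: c'_def single_add distrib_right)
      qed
      moreover have "?g - Poly_Mapping.single 0 d * p ?m \<in> below \<kappa> G n"
      proof -
        have "Poly_Mapping.single a 1 * rule_poly \<kappa> \<rho> - p ?m \<in> below \<kappa> G n"
          using link[OF step.hyps(2), of "rep ?m"] rep[OF m(1)] m(2)
          unfolding linked_def p_def by metis
        from below_single_0_mult[OF this, of d] show ?thesis
          by (simp add: right_diff_distrib mult.assoc[symmetric] mult_single)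
      qed
      then have "(f - top F c) + (?g - Poly_Mapping.single 0 d * p ?m) \<in> below \<kappa> G n"
        using F by (intro below_add) auto
      ultimately show ?thesis using F m
        by (intro exI[of _ "insert ?m F"] exI[of _ c']) (auto simp: algebra_simps)
    qed
  qed
  then obtain F c where F: "finite F" "\<And>m. m \<in> F \<Longrightarrow> reducible G m" "\<And>m. m \<in> F \<Longrightarrow> weight m = n"
    "f - top F c \<in> below \<kappa> G n" by auto
  have "c m = 0" if "m \<in> F" for m
  proof -
    have "Poly_Mapping.lookup (p m') m = (if m' = m then 1 else 0)" if "m' \<in> F" for m'
    proof -
      have "rep m' \<in> set G" "m' = shift m' + monom_of (fst (rep m'))"
        using rep F(2)[OF that] by auto
      then show ?thesis
        using lookup_shifted_rule[OF dec, of "rep m'" "shift m'" m 1 \<kappa>] F(3)[OF that] F(3)[OF \<open>m \<in> F\<close>]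
        unfolding p_def by (metis order_refl)
    qed
    then have "Poly_Mapping.lookup (top F c) m = (\<Sum>m'\<in>F. if m' = m then c m' else 0)"
      unfolding top_def lookup_sum
      by (intro sum.cong refl) (auto simp: lookup_single_mult)
    also have "\<dots> = c m" using that F(1) by simp
    finally have "Poly_Mapping.lookup (top F c) m = c m" .
    moreover have "Poly_Mapping.lookup (f - top F c) m = 0"
      using lookup_below[OF dec F(4)] F(3)[OF that] by simp
    moreover have "Poly_Mapping.lookup f m = 0"
      using irred[of m] F(2)[OF that] by (auto simp: in_keys_iff)
    ultimately show ?thesis by (simp add: lookup_minus)
  qed
  then have "top F c = 0" by (simp add: top_def)
  then show ?thesis using F(4) by simp
qed

lemma below_irreducible_0:
  fixes f :: "'k::field gpoly"
  assumes dec: "decreasing G" and link: "\<And>\<rho> \<sigma>. \<rho> \<in> set G \<Longrightarrow> \<sigma> \<in> set G \<Longrightarrow> linked \<kappa> G \<rho> \<sigma>"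
    and f: "f \<in> below \<kappa> G n"
    and irred: "\<And>m. m \<in> Poly_Mapping.keys f \<Longrightarrow> \<not> reducible G m"
  shows "f = 0"
  using f
proof (induction n)
  case 0
  then show ?case by (auto elim: below.cases)
next
  case (Suc n)
  then show ?case using below_Suc_lower[OF dec link _ irred] by blast
qed


section \<open>Reduction of term lists\<close>

fun reduct :: "rule list \<Rightarrow> gen list \<Rightarrow> (gen list \<times> trm list) option" where
  "reduct [] u = None"
| "reduct ((l, r) # G) u = (case quot u l of None \<Rightarrow> reduct G u | Some a \<Rightarrow> Some (a, r))"

text \<open>
  The head of the list is rewritten until nothing is left. The number bounds the count of rewriting
  steps, which makes the recursion structural.
\<close>

fun reduces_to_0 :: "rule list \<Rightarrow> nat \<Rightarrow> trm list \<Rightarrow> bool" where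
  "reduces_to_0 G n [] = True"
| "reduces_to_0 G 0 (t # p) = False"
| "reduces_to_0 G (Suc n) (Trm w u k c # p) =
     (case reduct G u of
        None \<Rightarrow> False
      | Some (a, r) \<Rightarrow> reduces_to_0 G n (add_terms p (scale (Trm (word_weight a) a k c) r)))"

lemma reduct_Some:
  "reduct G u = Some (a, r) \<Longrightarrow> \<exists>\<rho>\<in>set G. snd \<rho> = r \<and> monom_of u = monom_of a + monom_of (fst \<rho>)"
  by (induction G u rule: reduct.induct) (auto split: option.splits dest: quot_Some)

lemma reduct_below:
  assumes "decreasing G" "reduct G u = Some (a, r)"
  shows "Poly_Mapping.single (monom_of u) c - Poly_Mapping.single (monom_of a) c * val \<kappa> r
      \<in> below \<kappa> G (Suc (word_weight u))"
    and "\<exists>n. word_weight u = word_weight a + n \<and> words_below n r"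
proof -
  obtain \<rho> where \<rho>: "\<rho> \<in> set G" "snd \<rho> = r" "monom_of u = monom_of a + monom_of (fst \<rho>)"
    using reduct_Some[OF assms(2)] by auto
  have "Poly_Mapping.single (monom_of u) c - Poly_Mapping.single (monom_of a) c * val \<kappa> r
      = Poly_Mapping.single (monom_of a) c * rule_poly \<kappa> \<rho>"
    by (simp add: rule_poly_def right_diff_distrib mult_single \<rho>(2,3))
  moreover have "\<dots> \<in> below \<kappa> G (Suc (word_weight u))"
    using \<rho> by (intro below_rule) (simp_all add: weight_monom_of[symmetric])
  ultimately show "Poly_Mapping.single (monom_of u) c - Poly_Mapping.single (monom_of a) c * val \<kappa> r
      \<in> below \<kappa> G (Suc (word_weight u))" by simp
  have "word_weight u = word_weight a + word_weight (fst \<rho>)"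
    using \<rho>(3) by (metis weight_add weight_monom_of)
  then show "\<exists>n. word_weight u = word_weight a + n \<and> words_below n r"
    using \<rho> assms(1) unfolding decreasing_def by auto
qed

lemma reduces_to_0_below:
  assumes "decreasing G" "reduces_to_0 G m p" "words_below n p"
  shows "val \<kappa> p \<in> below \<kappa> G n"
  using assms
proof (induction G m p rule: reduces_to_0.induct)
  case (3 G m w u k c p)
  then obtain a r where ar: "reduct G u = Some (a, r)"
    and red: "reduces_to_0 G m (add_terms p (scale (Trm (word_weight a) a k c) r))"
    by (auto split: option.splits)
  let ?s = "Trm (word_weight a) a k c"
  let ?c = "of_int c * \<kappa> ^ k"
  have u: "word_weight u < n" and p: "words_below n p"
    using "3.prems"(3) by (auto simp: words_below_def)
  obtain l where l: "word_weight u = word_weight a + l" "words_below l r"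
    using reduct_below(2)[OF "3.prems"(1) ar] by auto
  have "words_below (word_weight u) (scale ?s r)"
    using words_below_scale[OF l(2), of ?s] l(1) by simp
  then have "words_below n (scale ?s r)"
    using u by (auto simp: words_below_def)
  then have *: "val \<kappa> (add_terms p (scale ?s r)) \<in> below \<kappa> G n"
    using "3.IH"[OF ar refl "3.prems"(1) red] p by (simp add: words_below_add_terms)
  have "Poly_Mapping.single (monom_of u) ?c - Poly_Mapping.single (monom_of a) ?c * val \<kappa> r
      \<in> below \<kappa> G n"
    by (rule below_mono[OF reduct_below(1)[OF "3.prems"(1) ar]]) (use u in simp)
  from below_add[OF * this] show ?case
    by (simp add: val_add_terms val_scale trm_val_def algebra_simps)
qed (simp_all add: below.zero)


section \<open>Buchberger's criterion\<close>

text \<open>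
  The leading terms cancel, so only the tails, multiplied up to the least common multiple of the
  leading words, remain.
\<close>

definition s_poly :: "rule \<Rightarrow> rule \<Rightarrow> trm list" where
  "s_poly \<rho> \<sigma> =
     add_terms (scale (tm 1 0 (missing (fst \<rho>) (fst \<sigma>))) (snd \<rho>))
          (scale (tm (- 1) 0 (missing (fst \<sigma>) (fst \<rho>))) (snd \<sigma>))"

definition coprime_words :: "gen list \<Rightarrow> gen list \<Rightarrow> bool" where
  "coprime_words u v \<longleftrightarrow> missing u v = v"

definition lcm_word :: "gen list \<Rightarrow> gen list \<Rightarrow> gen list" where
  "lcm_word u v = mult_word u (missing u v)"

text \<open>
  Buchberger's chain criterion for the pair of \<open>u\<close> and \<open>v\<close> with least common multiple \<open>w\<close>: some
  leading word \<open>l\<close> divides \<open>w\<close>, and both its pairs with \<open>u\<close> and \<open>v\<close> are settled, either by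
  coprimality or by induction on the weight of the least common multiple.
\<close>

definition settled :: "gen list \<Rightarrow> gen list \<Rightarrow> gen list \<Rightarrow> bool" where
  "settled w u v \<longleftrightarrow> coprime_words u v \<or> word_weight (lcm_word u v) < word_weight w"

fun bridged :: "gen list \<Rightarrow> gen list \<Rightarrow> gen list \<Rightarrow> rule list \<Rightarrow> bool" where
  "bridged w u v [] = False"
| "bridged w u v ((l, r) # G) =
     ((quot w l \<noteq> None \<and> settled w u l \<and> settled w l v) \<or> bridged w u v G)"

fun pair_ok :: "rule list \<Rightarrow> nat \<Rightarrow> rule \<Rightarrow> rule \<Rightarrow> bool" where
  "pair_ok G n (l, r) (l', r') =
     (coprime_words l l' \<or> bridged (lcm_word l l') l l' G
        \<or> reduces_to_0 G n (s_poly (l, r) (l', r')))"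

fun pairs_ok :: "rule list \<Rightarrow> nat \<Rightarrow> rule list \<Rightarrow> bool" where
  "pairs_ok G n [] = True"
| "pairs_ok G n (\<rho> # H) = (list_all (pair_ok G n \<rho>) H \<and> pairs_ok G n H)"

lemma lcm_commute:
  "monom_of u + monom_of (missing u v) = monom_of v + monom_of (missing v u)"
  by (rule poly_mapping_eqI) (simp add: lookup_add lookup_missing)

lemma lcm_least:
  assumes "a + monom_of u = b + monom_of v"
  shows "\<exists>c. a = c + monom_of (missing u v) \<and> b = c + monom_of (missing v u)"
proof (intro exI conjI; rule poly_mapping_eqI)
  fix g
  have *: "Poly_Mapping.lookup a g + Poly_Mapping.lookup (monom_of u) g
      = Poly_Mapping.lookup b g + Poly_Mapping.lookup (monom_of v) g" for g
    using arg_cong[OF assms, of "\<lambda>m. Poly_Mapping.lookup m g"] by (simp add: lookup_add)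
  let ?c = "a - monom_of (missing u v)"
  show "Poly_Mapping.lookup a g = Poly_Mapping.lookup (?c + monom_of (missing u v)) g"
    using *[of g] by (simp add: lookup_add lookup_minus lookup_missing)
  show "Poly_Mapping.lookup b g = Poly_Mapping.lookup (?c + monom_of (missing v u)) g"
    using *[of g] by (simp add: lookup_add lookup_minus lookup_missing)
qed

lemma word_weight_lcm: "word_weight (lcm_word u v) = weight (monom_of (missing u v) + monom_of u)"
  by (simp add: lcm_word_def weight_monom_of[symmetric] monom_of_mult_word add.commute)

lemma word_weight_lcm_commute: "word_weight (lcm_word u v) = word_weight (lcm_word v u)"
  by (simp add: word_weight_lcm lcm_commute add.commute[of "monom_of (missing _ _)"])

lemma linkedI:
  assumes "Poly_Mapping.single (monom_of (missing (fst \<rho>) (fst \<sigma>))) 1 * rule_poly \<kappa> \<rho>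
      - Poly_Mapping.single (monom_of (missing (fst \<sigma>) (fst \<rho>))) 1 * rule_poly \<kappa> \<sigma>
    \<in> below \<kappa> G (word_weight (lcm_word (fst \<rho>) (fst \<sigma>)))" (is "?f \<in> _")
  shows "linked \<kappa> G \<rho> \<sigma>"
  unfolding linked_def
proof (intro allI impI)
  fix a b
  assume "a + monom_of (fst \<rho>) = b + monom_of (fst \<sigma>)"
  from lcm_least[OF this] obtain c where
    c: "a = c + monom_of (missing (fst \<rho>) (fst \<sigma>))" "b = c + monom_of (missing (fst \<sigma>) (fst \<rho>))"
    by auto
  have "Poly_Mapping.single c 1 * ?f \<in> below \<kappa> G (weight c + word_weight (lcm_word (fst \<rho>) (fst \<sigma>)))"
    by (rule below_single_mult[OF assms])
  then show "Poly_Mapping.single a 1 * rule_poly \<kappa> \<rho> - Poly_Mapping.single b 1 * rule_poly \<kappa> \<sigma>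
      \<in> below \<kappa> G (weight (a + monom_of (fst \<rho>)))"
    by (simp add: c word_weight_lcm weight_add right_diff_distrib mult.assoc[symmetric] mult_single add.assoc)
qed

lemma linked_sym: "linked \<kappa> G \<rho> \<sigma> \<Longrightarrow> linked \<kappa> G \<sigma> \<rho>"
  unfolding linked_def
proof (intro allI impI)
  fix a b
  assume *: "\<forall>a b. a + monom_of (fst \<rho>) = b + monom_of (fst \<sigma>) \<longrightarrow>
        Poly_Mapping.single a 1 * rule_poly \<kappa> \<rho> - Poly_Mapping.single b 1 * rule_poly \<kappa> \<sigma>
          \<in> below \<kappa> G (weight (a + monom_of (fst \<rho>)))"
    and eq: "a + monom_of (fst \<sigma>) = b + monom_of (fst \<rho>)"
  then have "Poly_Mapping.single b 1 * rule_poly \<kappa> \<rho> - Poly_Mapping.single a 1 * rule_poly \<kappa> \<sigma>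
          \<in> below \<kappa> G (weight (a + monom_of (fst \<sigma>)))" by metis
  from below_uminus[OF this]
  show "Poly_Mapping.single a 1 * rule_poly \<kappa> \<sigma> - Poly_Mapping.single b 1 * rule_poly \<kappa> \<rho>
          \<in> below \<kappa> G (weight (a + monom_of (fst \<sigma>)))" by simp
qed

lemma linked_refl: "linked \<kappa> G \<rho> \<rho>"
  unfolding linked_def by (auto simp: below.zero)

lemma rule_poly_mult_below:
  assumes "\<rho> \<in> set G" "\<And>m. m \<in> Poly_Mapping.keys f \<Longrightarrow> weight m + word_weight (fst \<rho>) < n"
  shows "f * rule_poly \<kappa> \<rho> \<in> below \<kappa> G n"
  using assms(2)
proof (induction f rule: update_induct)
  case const
  then show ?case by (simp add: below.zero)
next
  case (update f m c)
  have eq: "Poly_Mapping.update m c f = f + Poly_Mapping.single m c"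
    using update.hyps by (simp add: update_eq_add)
  have keys: "Poly_Mapping.keys (Poly_Mapping.update m c f) = insert m (Poly_Mapping.keys f)"
    using update.hyps by (auto simp: keys_update)
  show ?case
    unfolding eq distrib_right
    using update keys by (intro below.step assms(1) update.IH) (auto simp: weight_add weight_monom_of)
qed

text \<open>
  For coprime leading monomials the S-polynomial of two rules is a combination of them in which
  each rule is multiplied by the tail of the other, hence by terms lighter than the leading monomial
  of the other.
\<close>

lemma linked_coprime:
  assumes "decreasing G" "\<rho> \<in> set G" "\<sigma> \<in> set G" "coprime_words (fst \<rho>) (fst \<sigma>)"
  shows "linked \<kappa> G \<rho> \<sigma>"
proof (rule linkedI)
  let ?l = "monom_of (fst \<rho>)" and ?m = "monom_of (fst \<sigma>)"
  let ?r = "val \<kappa> (snd \<rho>)" and ?s = "val \<kappa> (snd \<sigma>)"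
  have miss: "missing (fst \<rho>) (fst \<sigma>) = fst \<sigma>"
    using assms(4) by (simp add: coprime_words_def)
  then have miss': "monom_of (missing (fst \<sigma>) (fst \<rho>)) = ?l"
    using lcm_commute[of "fst \<rho>" "fst \<sigma>"]
    by (metis add.commute add_left_cancel)
  have n: "word_weight (lcm_word (fst \<rho>) (fst \<sigma>)) = weight ?l + weight ?m"
    by (simp add: word_weight_lcm miss weight_add)
  have "?s * rule_poly \<kappa> \<rho> \<in> below \<kappa> G (weight ?l + weight ?m)"
    using assms(1,3) keys_val_weight unfolding decreasing_def
    by (intro rule_poly_mult_below[OF assms(2)]) (fastforce simp: weight_monom_of)
  moreover have "?r * rule_poly \<kappa> \<sigma> \<in> below \<kappa> G (weight ?l + weight ?m)"
    using assms(1,2) keys_val_weight unfolding decreasing_def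
    by (intro rule_poly_mult_below[OF assms(3)]) (fastforce simp: weight_monom_of)
  ultimately have "?s * rule_poly \<kappa> \<rho> - ?r * rule_poly \<kappa> \<sigma> \<in> below \<kappa> G (weight ?l + weight ?m)"
    by (rule below_diff)
  moreover have "?s * rule_poly \<kappa> \<rho> - ?r * rule_poly \<kappa> \<sigma>
      = Poly_Mapping.single ?m 1 * rule_poly \<kappa> \<rho> - Poly_Mapping.single ?l 1 * rule_poly \<kappa> \<sigma>"
    by (simp add: rule_poly_def algebra_simps mult_single)
  ultimately show "Poly_Mapping.single (monom_of (missing (fst \<rho>) (fst \<sigma>))) 1 * rule_poly \<kappa> \<rho>
      - Poly_Mapping.single (monom_of (missing (fst \<sigma>) (fst \<rho>))) 1 * rule_poly \<kappa> \<sigma>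
    \<in> below \<kappa> G (word_weight (lcm_word (fst \<rho>) (fst \<sigma>)))"
    by (simp add: miss miss' n)
qed

lemma val_s_poly:
  "val \<kappa> (s_poly \<rho> \<sigma>) =
     Poly_Mapping.single (monom_of (missing (fst \<sigma>) (fst \<rho>))) 1 * rule_poly \<kappa> \<sigma>
     - Poly_Mapping.single (monom_of (missing (fst \<rho>) (fst \<sigma>))) 1 * rule_poly \<kappa> \<rho>"
  using lcm_commute[of "fst \<rho>" "fst \<sigma>"]
  by (simp add: s_poly_def val_add_terms val_scale trm_val_def tm_def rule_poly_def algebra_simps
      mult_single single_uminus)

lemma linked_reduces_to_0:
  assumes "decreasing G" "\<rho> \<in> set G" "\<sigma> \<in> set G" "reduces_to_0 G n (s_poly \<rho> \<sigma>)"
  shows "linked \<kappa> G \<rho> \<sigma>"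
proof (rule linkedI)
  have "words_below (word_weight (lcm_word u v)) (scale (tm c k (missing u v)) r)"
    if "words_below (word_weight u) r" for c k u v r
    using words_below_scale[OF that, of "tm c k (missing u v)"]
    by (simp add: lcm_word_def tm_def word_weight_mult_word add.commute)
  then have "words_below (word_weight (lcm_word (fst \<rho>) (fst \<sigma>))) (s_poly \<rho> \<sigma>)"
    using assms(1-3) unfolding s_poly_def decreasing_def
    by (intro words_below_add_terms) (metis word_weight_lcm_commute)+
  from below_uminus[OF reduces_to_0_below[OF assms(1,4) this, of \<kappa>]]
  show "Poly_Mapping.single (monom_of (missing (fst \<rho>) (fst \<sigma>))) 1 * rule_poly \<kappa> \<rho>
      - Poly_Mapping.single (monom_of (missing (fst \<sigma>) (fst \<rho>))) 1 * rule_poly \<kappa> \<sigma>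
    \<in> below \<kappa> G (word_weight (lcm_word (fst \<rho>) (fst \<sigma>)))"
    by (simp add: val_s_poly)
qed

lemma bridgedD:
  "bridged w u v G \<Longrightarrow> \<exists>\<tau>\<in>set G. (\<exists>a. monom_of w = a + monom_of (fst \<tau>))
     \<and> settled w u (fst \<tau>) \<and> settled w (fst \<tau>) v"
  by (induction w u v G rule: bridged.induct) (auto dest: quot_Some)

lemma linked_bridge:
  assumes "linked \<kappa> G \<rho> \<tau>" "linked \<kappa> G \<tau> \<sigma>"
    and "monom_of (lcm_word (fst \<rho>) (fst \<sigma>)) = a + monom_of (fst \<tau>)"
  shows "linked \<kappa> G \<rho> \<sigma>"
proof (rule linkedI)
  let ?x = "monom_of (missing (fst \<rho>) (fst \<sigma>))" and ?y = "monom_of (missing (fst \<sigma>) (fst \<rho>))"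
  let ?n = "word_weight (lcm_word (fst \<rho>) (fst \<sigma>))"
  have eq: "?x + monom_of (fst \<rho>) = a + monom_of (fst \<tau>)" "a + monom_of (fst \<tau>) = ?y + monom_of (fst \<sigma>)"
    using assms(3) lcm_commute[of "fst \<rho>" "fst \<sigma>"]
    by (simp_all add: lcm_word_def monom_of_mult_word add.commute)
  have n: "weight (?x + monom_of (fst \<rho>)) = ?n" "weight (a + monom_of (fst \<tau>)) = ?n"
    using eq by (simp_all add: word_weight_lcm)
  have "Poly_Mapping.single ?x 1 * rule_poly \<kappa> \<rho> - Poly_Mapping.single a 1 * rule_poly \<kappa> \<tau>
      \<in> below \<kappa> G ?n"
    using assms(1) eq(1) n(1) unfolding linked_def by metis
  moreover have "Poly_Mapping.single a 1 * rule_poly \<kappa> \<tau> - Poly_Mapping.single ?y 1 * rule_poly \<kappa> \<sigma>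
      \<in> below \<kappa> G ?n"
    using assms(2) eq(2) n(2) unfolding linked_def by metis
  ultimately show "Poly_Mapping.single ?x 1 * rule_poly \<kappa> \<rho> - Poly_Mapping.single ?y 1 * rule_poly \<kappa> \<sigma>
      \<in> below \<kappa> G ?n"
    using below_add by fastforce
qed

lemma pairs_ok_cases:
  "pairs_ok G n H \<Longrightarrow> \<rho> \<in> set H \<Longrightarrow> \<sigma> \<in> set H
    \<Longrightarrow> \<rho> = \<sigma> \<or> pair_ok G n \<rho> \<sigma> \<or> pair_ok G n \<sigma> \<rho>"
  by (induction H) (auto simp: list_all_iff)

text \<open>
  By induction on the weight of the least common multiple of the leading words, so that the chain
  criterion may use pairs with a lighter one.
\<close>

lemma buchberger:
  assumes dec: "decreasing G" and ok: "pairs_ok G n G"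
    and "\<rho> \<in> set G" "\<sigma> \<in> set G"
  shows "linked \<kappa> G \<rho> \<sigma>"
  using assms(3,4)
proof (induction "word_weight (lcm_word (fst \<rho>) (fst \<sigma>))" arbitrary: \<rho> \<sigma> rule: less_induct)
  case less
  have linked: "linked \<kappa> G \<rho> \<sigma>" if that: "\<rho> \<in> set G" "\<sigma> \<in> set G" and pair: "pair_ok G n \<rho> \<sigma>"
    and IH: "\<And>\<rho>' \<sigma>'. word_weight (lcm_word (fst \<rho>') (fst \<sigma>')) < word_weight (lcm_word (fst \<rho>) (fst \<sigma>))
        \<Longrightarrow> \<rho>' \<in> set G \<Longrightarrow> \<sigma>' \<in> set G \<Longrightarrow> linked \<kappa> G \<rho>' \<sigma>'" for \<rho> \<sigma>
  proof -
    consider "coprime_words (fst \<rho>) (fst \<sigma>)"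
      | "bridged (lcm_word (fst \<rho>) (fst \<sigma>)) (fst \<rho>) (fst \<sigma>) G"
      | "reduces_to_0 G n (s_poly \<rho> \<sigma>)"
      using pair by (cases \<rho>; cases \<sigma>) auto
    then show ?thesis
    proof cases
      case 1
      then show ?thesis
        using linked_coprime[OF dec] \<open>\<rho> \<in> set G\<close> \<open>\<sigma> \<in> set G\<close> by blast
    next
      case 3
      then show ?thesis
        using linked_reduces_to_0[OF dec] \<open>\<rho> \<in> set G\<close> \<open>\<sigma> \<in> set G\<close> by blast
    next
      case 2
      from bridgedD[OF this] obtain \<tau> a where \<tau>: "\<tau> \<in> set G"
        "monom_of (lcm_word (fst \<rho>) (fst \<sigma>)) = a + monom_of (fst \<tau>)"
        "settled (lcm_word (fst \<rho>) (fst \<sigma>)) (fst \<rho>) (fst \<tau>)"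
        "settled (lcm_word (fst \<rho>) (fst \<sigma>)) (fst \<tau>) (fst \<sigma>)" by auto
      have "linked \<kappa> G \<rho> \<tau>" "linked \<kappa> G \<tau> \<sigma>"
        using \<tau> \<open>\<rho> \<in> set G\<close> \<open>\<sigma> \<in> set G\<close> IH linked_coprime[OF dec] unfolding settled_def by blast+
      then show ?thesis using \<tau>(2) by (rule linked_bridge)
    qed
  qed
  consider "\<rho> = \<sigma>" | "pair_ok G n \<rho> \<sigma>" | "pair_ok G n \<sigma> \<rho>"
    using pairs_ok_cases[OF ok less.prems] by auto
  then show ?case
  proof cases
    case 2
    then show ?thesis using linked[OF less.prems] less.hyps by blast
  next
    case 3
    then have "linked \<kappa> G \<sigma> \<rho>"
      using linked[OF less.prems(2,1)] less.hyps
      by (metis word_weight_lcm_commute)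
    then show ?thesis by (rule linked_sym)
  qed (simp add: linked_refl)
qed


section \<open>Deriving rules from relations\<close>

text \<open>
  A derivation lists rules, each with a scalar \<open>c\<kappa>\<^sup>k\<close> and a source, such that \<open>c\<kappa>\<^sup>k\<close> times the rule is
  congruent to the source modulo the preceding rules. The source is the next one of the given
  relations or the S-polynomial of the rules that apply to two given words.
\<close>

datatype source = Relation | Overlap "gen list" "gen list"

type_synonym derivation_step = "source \<times> nat \<times> int \<times> rule"

definition one_step :: "rule list \<Rightarrow> gen list \<Rightarrow> trm list" where
  "one_step G u = (case reduct G u of None \<Rightarrow> [tm 1 0 u] | Some (a, r) \<Rightarrow> scale (tm 1 0 a) r)"

definition overlap :: "rule list \<Rightarrow> gen list \<Rightarrow> gen list \<Rightarrow> trm list" where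
  "overlap G u v = s_poly (u, one_step G u) (v, one_step G v)"

definition minus_rule :: "trm list \<Rightarrow> nat \<Rightarrow> int \<Rightarrow> rule \<Rightarrow> trm list" where
  "minus_rule p k c \<rho> = add_terms p (add_terms [Trm (word_weight (fst \<rho>)) (fst \<rho>) k (- c)] (scale (tm c k []) (snd \<rho>)))"

fun derived :: "rule list \<Rightarrow> nat \<Rightarrow> trm list list \<Rightarrow> derivation_step list \<Rightarrow> bool" where
  "derived G n R [] = True"
| "derived G n [] ((Relation, k, c, \<rho>) # D) = False"
| "derived G n (p # R) ((Relation, k, c, \<rho>) # D) =
     (reduces_to_0 G n (minus_rule p k c \<rho>) \<and> derived (G @ [\<rho>]) n R D)"
| "derived G n R ((Overlap u v, k, c, \<rho>) # D) =
     (reduces_to_0 G n (minus_rule (overlap G u v) k c \<rho>) \<and> derived (G @ [\<rho>]) n R D)"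

section \<open>The Groebner basis\<close>

text \<open>
  The relations (a), (b), (c) and (d) as term lists. Those of type (c) start with the fourth: each
  of the first three shares a product of two generators \<open>O\<^sub>i\<^sub>j\<^sub>k\<close> with one of the other three, and
  subtracting the latter leaves \<open>\<kappa>\<close> times a rule with a cubic leading monomial. Relation (d) is
  doubled, which clears the denominators of \<open>\<kappa>/2\<close>.
\<close>

definition relation_terms :: "trm list list" where
  "relation_terms = [
   [tm (-1) 0 [O34, O45], tm 1 0 [O4, O345], tm 1 0 [O3, O5], tm (-1) 1 [O1]],
   [tm (-1) 0 [O45, O56], tm 1 0 [O5, O123], tm 1 0 [O4, O6], tm (-1) 1 [O2]],
   [tm (-1) 0 [O56, O61], tm 1 0 [O6, O234], tm 1 0 [O1, O5], tm (-1) 1 [O3]],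
   [tm (-1) 0 [O12, O61], tm 1 0 [O1, O345], tm 1 0 [O2, O6], tm (-1) 1 [O4]],
   [tm (-1) 0 [O12, O23], tm 1 0 [O2, O123], tm 1 0 [O1, O3], tm (-1) 1 [O5]],
   [tm (-1) 0 [O23, O34], tm 1 0 [O3, O234], tm 1 0 [O2, O4], tm (-1) 1 [O6]],
   [tm 1 0 [O45, O234], tm (-1) 0 [O5, O23], tm 1 1 [O1, O2], tm (-1) 0 [O4, O61], tm (-1) 1 [O12]],
   [tm 1 0 [O56, O345], tm (-1) 0 [O5, O12], tm 1 1 [O2, O3], tm (-1) 0 [O6, O34], tm (-1) 1 [O23]],
   [tm 1 0 [O61, O123], tm (-1) 0 [O6, O23], tm 1 1 [O3, O4], tm (-1) 0 [O1, O45], tm (-1) 1 [O34]],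
   [tm 1 0 [O12, O234], tm (-1) 0 [O2, O56], tm (-1) 0 [O1, O34], tm 1 1 [O4, O5], tm (-1) 1 [O45]],
   [tm 1 0 [O23, O345], tm (-1) 0 [O2, O45], tm (-1) 0 [O3, O61], tm 1 1 [O5, O6], tm (-1) 1 [O56]],
   [tm 1 0 [O34, O123], tm (-1) 0 [O3, O56], tm (-1) 0 [O4, O12], tm 1 1 [O1, O6], tm (-1) 1 [O61]],
   [tm 1 0 [O123, O234], tm (-1) 0 [O23, O56], tm 1 1 [O3, O4, O5], tm (-1) 1 [O3, O45],
     tm (-1) 1 [O5, O34], tm (-1) 0 [O1, O4], tm 1 1 [O345]],
   [tm 1 0 [O234, O345], tm 1 1 [O4, O5, O6], tm (-1) 1 [O4, O56], tm (-1) 0 [O34, O61],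
     tm (-1) 0 [O2, O5], tm (-1) 1 [O6, O45], tm 1 1 [O123]],
   [tm 1 0 [O123, O345], tm (-1) 0 [O12, O45], tm 1 1 [O1, O5, O6], tm (-1) 1 [O1, O56],
     tm (-1) 0 [O3, O6], tm (-1) 1 [O5, O61], tm 1 1 [O234]],
   [tm 1 1 [O1, O2, O6], tm 1 0 [O123, O234], tm (-1) 0 [O23, O56], tm (-1) 1 [O6, O12],
     tm (-1) 1 [O2, O61], tm (-1) 0 [O1, O4], tm 1 1 [O345]],
   [tm 1 1 [O1, O2, O3], tm 1 0 [O234, O345], tm (-1) 1 [O3, O12], tm (-1) 1 [O1, O23],
     tm (-1) 0 [O34, O61], tm (-1) 0 [O2, O5], tm 1 1 [O123]],
   [tm 1 1 [O2, O3, O4], tm 1 0 [O123, O345], tm (-1) 0 [O12, O45], tm (-1) 1 [O2, O34],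
     tm (-1) 1 [O4, O23], tm (-1) 0 [O3, O6], tm 1 1 [O234]],
   [tm 2 0 [O123, O234, O345], tm 1 1 [O2, O3, O23], tm 1 1 [O1, O2, O12],
     tm (-2) 0 [O2, O5, O123], tm (-2) 0 [O3, O6, O234], tm (-1) 1 [O12, O12],
     tm 1 1 [O5, O6, O56], tm 1 1 [O3, O4, O34], tm (-2) 0 [O1, O4, O345], tm (-1) 1 [O56, O56],
     tm (-1) 1 [O23, O23], tm (-2) 0 [O2, O4, O6], tm 1 1 [O1, O6, O61], tm (-2) 0 [O1, O3, O5],
     tm 1 1 [O4, O5, O45], tm (-1) 1 [O34, O34], tm (-1) 1 [O45, O45], tm (-1) 1 [O61, O61],
     tm 2 3 []]]"

text \<open>
  The first 18 rules come from the relations (a), (b) and (c). Every later one is the S-polynomial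
  of two earlier rules or, in one case, relation (d), reduced by the earlier rules and divided by
  \<open>c\<kappa>\<^sup>k\<close>. The tails are completely reduced, so that these rules form the reduced Groebner basis.
\<close>

definition derivation :: "derivation_step list" where
  "derivation = [
   (Relation, 0, -1, [O34, O45], [tm 1 0 [O4, O345], tm 1 0 [O3, O5], tm (-1) 1 [O1]]),
   (Relation, 0, -1, [O45, O56], [tm 1 0 [O5, O123], tm 1 0 [O4, O6], tm (-1) 1 [O2]]),
   (Relation, 0, -1, [O56, O61], [tm 1 0 [O6, O234], tm 1 0 [O1, O5], tm (-1) 1 [O3]]),
   (Relation, 0, -1, [O12, O61], [tm 1 0 [O1, O345], tm 1 0 [O2, O6], tm (-1) 1 [O4]]),
   (Relation, 0, -1, [O12, O23], [tm 1 0 [O2, O123], tm 1 0 [O1, O3], tm (-1) 1 [O5]]),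
   (Relation, 0, -1, [O23, O34], [tm 1 0 [O3, O234], tm 1 0 [O2, O4], tm (-1) 1 [O6]]),
   (Relation, 0, 1, [O45, O234], [tm 1 0 [O5, O23], tm (-1) 1 [O1, O2], tm 1 0 [O4, O61],
     tm 1 1 [O12]]),
   (Relation, 0, 1, [O56, O345], [tm 1 0 [O5, O12], tm (-1) 1 [O2, O3], tm 1 0 [O6, O34],
     tm 1 1 [O23]]),
   (Relation, 0, 1, [O61, O123], [tm 1 0 [O6, O23], tm (-1) 1 [O3, O4], tm 1 0 [O1, O45],
     tm 1 1 [O34]]),
   (Relation, 0, 1, [O12, O234], [tm 1 0 [O2, O56], tm 1 0 [O1, O34], tm (-1) 1 [O4, O5],
     tm 1 1 [O45]]),
   (Relation, 0, 1, [O23, O345], [tm 1 0 [O2, O45], tm 1 0 [O3, O61], tm (-1) 1 [O5, O6],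
     tm 1 1 [O56]]),
   (Relation, 0, 1, [O34, O123], [tm 1 0 [O3, O56], tm 1 0 [O4, O12], tm (-1) 1 [O1, O6],
     tm 1 1 [O61]]),
   (Relation, 0, 1, [O123, O234], [tm 1 0 [O23, O56], tm (-1) 1 [O3, O4, O5], tm 1 1 [O3, O45],
     tm 1 1 [O5, O34], tm 1 0 [O1, O4], tm (-1) 1 [O345]]),
   (Relation, 0, 1, [O234, O345], [tm (-1) 1 [O4, O5, O6], tm 1 1 [O4, O56], tm 1 0 [O34, O61],
     tm 1 0 [O2, O5], tm 1 1 [O6, O45], tm (-1) 1 [O123]]),
   (Relation, 0, 1, [O123, O345], [tm 1 0 [O12, O45], tm (-1) 1 [O1, O5, O6], tm 1 1 [O1, O56],
     tm 1 0 [O3, O6], tm 1 1 [O5, O61], tm (-1) 1 [O234]]),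
   (Relation, 1, 1, [O1, O2, O6], [tm 1 0 [O3, O4, O5], tm 1 0 [O6, O12], tm 1 0 [O2, O61],
     tm (-1) 0 [O3, O45], tm (-1) 0 [O5, O34]]),
   (Relation, 1, 1, [O1, O2, O3], [tm 1 0 [O3, O12], tm 1 0 [O4, O5, O6], tm 1 0 [O1, O23],
     tm (-1) 0 [O4, O56], tm (-1) 0 [O6, O45]]),
   (Relation, 1, 1, [O2, O3, O4], [tm 1 0 [O1, O5, O6], tm 1 0 [O2, O34], tm (-1) 0 [O1, O56],
     tm 1 0 [O4, O23], tm (-1) 0 [O5, O61]]),
   (Overlap [O34, O45] [O45, O234], 1, 1, [O1, O2, O34], [tm 1 0 [O4, O4, O5, O6],
     tm (-1) 0 [O4, O4, O56], tm 1 0 [O12, O34], tm (-1) 0 [O4, O6, O45], tm 1 0 [O4, O123],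
     tm 1 0 [O1, O234], tm (-1) 0 [O5, O6]]),
   (Overlap [O61, O123] [O34, O123], 1, -1, [O3, O4, O34], [tm 1 0 [O1, O6, O61],
     tm 1 0 [O34, O34], tm 1 0 [O3, O3], tm (-1) 0 [O61, O61], tm (-1) 0 [O6, O6],
     tm (-1) 0 [O1, O1], tm 1 0 [O4, O4]]),
   (Overlap [O45, O234] [O234, O345], 1, -1, [O1, O2, O345], [tm 1 0 [O4, O5, O6, O45],
     tm (-1) 0 [O4, O5, O123], tm 1 0 [O12, O345], tm (-1) 0 [O6, O45, O45], tm 1 0 [O45, O123],
     tm (-1) 0 [O4, O4, O6], tm (-1) 0 [O5, O5, O6], tm 1 0 [O5, O56], tm 1 1 [O2, O4],
     tm 1 0 [O1, O61]]),
   (Overlap [O56, O61] [O56, O345], 1, -1, [O4, O5, O6, O6], [tm 1 0 [O2, O3, O61],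
     tm 1 0 [O4, O6, O56], tm 1 0 [O6, O6, O45], tm (-1) 0 [O6, O123], tm (-1) 0 [O3, O345],
     tm (-1) 0 [O23, O61], tm 1 0 [O4, O5]]),
   (Overlap [O34, O45] [O34, O123], 1, -1, [O1, O4, O5, O6], [tm 1 0 [O1, O4, O56],
     tm 1 0 [O1, O6, O45], tm 1 0 [O4, O5, O61], tm (-1) 0 [O1, O123], tm 1 0 [O2, O3],
     tm (-1) 0 [O4, O234], tm (-1) 0 [O45, O61]]),
   (Overlap [O45, O56] [O56, O345], 1, 1, [O2, O3, O45], [tm 1 0 [O1, O5, O5, O6],
     tm (-1) 0 [O1, O5, O56], tm 1 0 [O2, O345], tm 1 0 [O23, O45], tm (-1) 0 [O5, O5, O61],
     tm 1 0 [O5, O234], tm (-1) 0 [O1, O6]]),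
   (Overlap [O61, O123] [O123, O345], 1, 1, [O1, O5, O6, O61], [tm 1 0 [O3, O4, O345],
     tm 1 0 [O1, O6, O234], tm 1 0 [O5, O61, O61], tm (-1) 0 [O34, O345], tm 1 0 [O5, O6, O6],
     tm 1 0 [O1, O1, O5], tm (-1) 0 [O61, O234], tm (-1) 0 [O6, O56], tm (-1) 1 [O1, O3],
     tm (-1) 0 [O4, O45]]),
   (Overlap [O45, O56] [O45, O234], 1, 1, [O1, O2, O56], [tm 1 0 [O3, O4, O5, O5],
     tm 1 0 [O12, O56], tm (-1) 0 [O3, O5, O45], tm (-1) 0 [O5, O5, O34], tm 1 0 [O2, O234],
     tm 1 0 [O5, O345], tm (-1) 0 [O3, O4]]),
   (Overlap [O61, O123] [O123, O234], 1, 1, [O3, O4, O5, O61], [tm 1 0 [O3, O4, O234],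
     tm 1 0 [O3, O45, O61], tm 1 0 [O1, O1, O2], tm 1 0 [O5, O34, O61], tm (-1) 0 [O34, O234],
     tm (-1) 0 [O3, O23], tm (-1) 0 [O1, O12], tm (-1) 0 [O61, O345]]),
   (Overlap [O45, O234] [O123, O234], 1, -1, [O1, O2, O123], [tm 1 0 [O3, O4, O5, O45],
     tm 1 0 [O12, O123], tm (-1) 0 [O3, O45, O45], tm (-1) 0 [O4, O5, O345], tm 1 0 [O2, O23],
     tm (-1) 0 [O3, O4, O4], tm (-1) 0 [O3, O5, O5], tm 1 0 [O45, O345], tm 1 0 [O4, O34],
     tm 1 1 [O1, O5]]),
   (Overlap [O56, O61] [O61, O123], 1, -1, [O3, O4, O5, O6], [tm 1 0 [O3, O4, O56],
     tm 1 0 [O3, O6, O45], tm 1 0 [O5, O6, O34], tm (-1) 0 [O34, O56], tm (-1) 0 [O3, O123],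
     tm (-1) 0 [O6, O345], tm 1 0 [O1, O2]]),
   (Overlap [O1, O2, O3] [O2, O3, O4], 0, 1, [O3, O4, O12], [tm 1 0 [O1, O1, O5, O6],
     tm (-1) 0 [O1, O1, O56], tm 1 0 [O12, O34], tm (-1) 0 [O1, O5, O61], tm 1 0 [O4, O123],
     tm 1 0 [O1, O234], tm (-1) 0 [O5, O6]]),
   (Overlap [O45, O234] [O12, O234], 1, -1, [O1, O2, O12], [tm 1 0 [O12, O12],
     tm 1 0 [O4, O5, O45], tm 1 0 [O2, O2], tm (-1) 0 [O45, O45], tm 1 0 [O1, O1],
     tm (-1) 0 [O4, O4], tm (-1) 0 [O5, O5]]),
   (Overlap [O1, O2, O6] [O1, O2, O3], 0, 1, [O3, O3, O4, O5], [tm 1 0 [O1, O6, O23],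
     tm 1 0 [O3, O3, O45], tm 1 0 [O3, O5, O34], tm (-1) 0 [O6, O123], tm (-1) 0 [O3, O345],
     tm (-1) 0 [O23, O61], tm 1 0 [O4, O5]]),
   (Overlap [O34, O45] [O3, O4, O34], 0, 1, [O3, O4, O4, O345], [tm 1 0 [O1, O6, O45, O61],
     tm 1 0 [O4, O34, O345], tm (-1) 0 [O1, O6, O23], tm (-1) 0 [O45, O61, O61],
     tm (-1) 0 [O6, O6, O45], tm 1 1 [O1, O3, O4], tm (-1) 0 [O1, O1, O45],
     tm 1 0 [O4, O4, O45], tm 1 0 [O6, O123], tm 1 0 [O3, O345], tm 1 0 [O23, O61],
     tm (-1) 1 [O1, O34], tm (-1) 0 [O4, O5]]),
   (Overlap [O34, O123] [O123, O345], 1, 1, [O1, O5, O6, O34], [tm 1 0 [O1, O34, O56],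
     tm 1 0 [O2, O3, O3], tm 1 0 [O1, O6, O345], tm 1 0 [O5, O34, O61], tm (-1) 0 [O34, O234],
     tm (-1) 0 [O3, O23], tm (-1) 0 [O1, O12], tm (-1) 0 [O61, O345]]),
   (Overlap [O1, O2, O3] [O2, O3, O45], 0, -1, [O1, O1, O5, O5, O6], [tm 1 0 [O1, O1, O5, O56],
     tm 1 0 [O3, O12, O45], tm 1 0 [O1, O5, O5, O61], tm (-1) 0 [O1, O5, O234],
     tm (-1) 0 [O12, O345], tm 1 0 [O1, O1, O6], tm (-1) 0 [O45, O123], tm 1 0 [O5, O5, O6],
     tm (-1) 0 [O5, O56], tm (-1) 0 [O1, O61]]),
   (Overlap [O56, O345] [O234, O345], 1, 1, [O4, O5, O6, O56], [tm 1 0 [O2, O3, O234],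
     tm 1 0 [O4, O56, O56], tm 1 0 [O5, O6, O123], tm (-1) 0 [O56, O123], tm (-1) 0 [O23, O234],
     tm 1 0 [O4, O6, O6], tm (-1) 0 [O3, O34], tm 1 0 [O4, O5, O5], tm (-1) 1 [O2, O6],
     tm (-1) 0 [O5, O45]]),
   (Overlap [O23, O345] [O234, O345], 1, 1, [O4, O5, O6, O23], [tm 1 0 [O4, O23, O56],
     tm 1 0 [O6, O23, O45], tm 1 0 [O1, O2, O2], tm 1 0 [O5, O6, O234], tm (-1) 0 [O23, O123],
     tm (-1) 0 [O56, O234], tm (-1) 0 [O2, O12], tm (-1) 0 [O6, O61]]),
   (Overlap [O56, O345] [O23, O345], 1, -1, [O2, O3, O23], [tm 1 0 [O5, O6, O56],
     tm (-1) 0 [O56, O56], tm 1 0 [O23, O23], tm 1 0 [O2, O2], tm 1 0 [O3, O3],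
     tm (-1) 0 [O6, O6], tm (-1) 0 [O5, O5]]),
   (Relation, 1, -2, [O3, O4, O5, O345], [tm 1 0 [O3, O45, O345], tm 1 0 [O5, O34, O345],
     tm (-1) 0 [O345, O345], tm 1 0 [O1, O6, O61], tm 1 0 [O4, O5, O45], tm (-1) 0 [O45, O45],
     tm (-1) 0 [O61, O61], tm (-1) 0 [O6, O6], tm (-1) 0 [O5, O5], tm 1 2 []]),
   (Overlap [O123, O234] [O234, O345], 1, 1, [O4, O5, O6, O123], [tm 1 0 [O4, O56, O123],
     tm 1 0 [O6, O45, O123], tm (-1) 0 [O123, O123], tm 1 0 [O5, O6, O56], tm (-1) 0 [O56, O56],
     tm 1 0 [O4, O5, O45], tm 1 0 [O2, O2], tm (-1) 0 [O45, O45], tm (-1) 0 [O6, O6],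
     tm (-1) 0 [O4, O4], tm (-1) 0 [O5, O5], tm 1 2 []]),
   (Overlap [O123, O234] [O123, O345], 1, 1, [O1, O5, O6, O234], [tm 1 0 [O1, O56, O234],
     tm 1 0 [O5, O61, O234], tm 1 0 [O5, O6, O56], tm (-1) 0 [O56, O56], tm (-1) 0 [O234, O234],
     tm 1 0 [O1, O6, O61], tm 1 0 [O3, O3], tm (-1) 0 [O61, O61], tm (-1) 0 [O6, O6],
     tm (-1) 0 [O1, O1], tm (-1) 0 [O5, O5], tm 1 2 []]),
   (Overlap [O12, O234] [O234, O345], 1, 1, [O4, O5, O6, O12], [tm 1 0 [O4, O12, O56],
     tm 1 0 [O2, O2, O3], tm 1 0 [O6, O12, O45], tm (-1) 0 [O12, O123], tm 1 0 [O4, O5, O345],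
     tm (-1) 0 [O2, O23], tm (-1) 0 [O45, O345], tm (-1) 0 [O4, O34]]),
   (Overlap [O56, O345] [O123, O345], 1, 1, [O1, O5, O6, O56], [tm 1 0 [O2, O3, O123],
     tm 1 0 [O1, O56, O56], tm 1 0 [O5, O6, O234], tm (-1) 0 [O23, O123], tm (-1) 0 [O56, O234],
     tm (-1) 0 [O2, O12], tm 1 0 [O1, O6, O6], tm 1 0 [O1, O5, O5], tm (-1) 0 [O6, O61],
     tm (-1) 1 [O3, O5]]),
   (Overlap [O23, O345] [O123, O345], 1, 1, [O1, O5, O6, O23], [tm 1 0 [O1, O23, O56],
     tm 1 0 [O5, O6, O123], tm 1 0 [O5, O23, O61], tm (-1) 0 [O56, O123], tm 1 0 [O3, O3, O4],
     tm (-1) 0 [O23, O234], tm (-1) 0 [O3, O34], tm (-1) 0 [O5, O45]]),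
   (Overlap [O4, O5, O6, O6] [O3, O4, O5, O6], 0, 1, [O2, O3, O3, O61], [tm 1 0 [O5, O6, O6, O34],
     tm (-1) 0 [O6, O34, O56], tm 1 0 [O3, O3, O345], tm 1 0 [O3, O23, O61],
     tm (-1) 0 [O6, O6, O345], tm 1 0 [O6, O12], tm 1 0 [O2, O61], tm (-1) 0 [O3, O45],
     tm (-1) 0 [O5, O34]]),
   (Overlap [O23, O34] [O3, O4, O34], 0, 1, [O3, O3, O4, O234], [tm 1 0 [O1, O6, O23, O61],
     tm 1 0 [O3, O34, O234], tm 1 0 [O3, O3, O23], tm (-1) 0 [O23, O61, O61],
     tm (-1) 0 [O6, O6, O23], tm (-1) 0 [O1, O1, O23], tm 1 1 [O3, O4, O6],
     tm (-1) 0 [O1, O6, O45], tm 1 0 [O1, O123], tm (-1) 0 [O2, O3], tm 1 0 [O4, O234],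
     tm (-1) 1 [O6, O34], tm 1 0 [O45, O61]]),
   (Overlap [O3, O4, O5, O6] [O3, O3, O4, O5], 0, 1, [O3, O3, O4, O56], [tm 1 0 [O1, O6, O6, O23],
     tm 1 0 [O3, O34, O56], tm 1 0 [O3, O3, O123], tm (-1) 0 [O6, O6, O123],
     tm (-1) 0 [O6, O23, O61], tm (-1) 0 [O3, O12], tm (-1) 0 [O1, O23], tm 1 0 [O4, O56],
     tm 1 0 [O6, O45]]),
   (Overlap [O1, O2, O3] [O1, O2, O123], 0, -1, [O1, O6, O23, O45], [tm 1 0 [O1, O23, O123],
     tm 1 0 [O3, O3, O4, O4], tm 1 0 [O6, O45, O123], tm 1 0 [O23, O45, O61],
     tm (-1) 0 [O123, O123], tm (-1) 0 [O23, O23], tm (-1) 0 [O1, O6, O61],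
     tm (-1) 0 [O34, O34], tm (-2) 0 [O3, O3], tm (-1) 0 [O45, O45], tm 1 0 [O61, O61],
     tm 1 0 [O6, O6], tm 1 0 [O1, O1], tm (-2) 0 [O4, O4], tm 1 2 []]),
   (Overlap [O1, O4, O5, O6] [O4, O5, O6, O23], 0, -1, [O1, O1, O2, O2],
     [tm 1 0 [O4, O5, O23, O61], tm (-1) 0 [O4, O23, O234], tm (-1) 0 [O23, O45, O61],
     tm 1 0 [O12, O12], tm (-1) 0 [O5, O61, O234], tm 1 0 [O23, O23], tm 1 0 [O234, O234],
     tm 1 0 [O4, O5, O45], tm 2 0 [O2, O2], tm (-1) 0 [O45, O45], tm 1 0 [O61, O61],
     tm 2 0 [O1, O1], tm (-1) 0 [O4, O4], tm (-1) 0 [O5, O5], tm (-1) 2 []]),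
   (Overlap [O3, O4, O5, O6] [O4, O5, O6, O56], 0, -1, [O2, O3, O3, O234],
     [tm 1 0 [O5, O6, O34, O56], tm (-1) 0 [O34, O56, O56], tm 1 0 [O3, O23, O234],
     tm 1 0 [O3, O3, O34], tm (-1) 0 [O5, O6, O12], tm 1 1 [O2, O3, O6], tm 1 0 [O12, O56],
     tm (-1) 0 [O6, O6, O34], tm (-1) 0 [O5, O5, O34], tm 1 0 [O2, O234], tm (-1) 1 [O6, O23],
     tm 1 0 [O5, O345], tm (-1) 0 [O3, O4]]),
   (Overlap [O1, O2, O6] [O1, O5, O6, O34], 0, -1, [O2, O2, O3, O3], [tm 1 0 [O5, O6, O12, O34],
     tm (-1) 0 [O12, O34, O56], tm (-1) 0 [O6, O12, O345], tm (-1) 0 [O5, O34, O345],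
     tm 1 0 [O12, O12], tm 1 0 [O5, O6, O56], tm (-1) 0 [O56, O56], tm 1 0 [O23, O23],
     tm 1 0 [O345, O345], tm 1 0 [O34, O34], tm 2 0 [O2, O2], tm 2 0 [O3, O3],
     tm (-1) 0 [O6, O6], tm (-1) 0 [O5, O5], tm (-1) 2 []]),
   (Overlap [O1, O2, O6] [O1, O5, O6, O56], 0, -1, [O2, O2, O3, O123], [tm 1 0 [O5, O6, O12, O56],
     tm (-1) 0 [O12, O56, O56], tm 1 0 [O2, O23, O123], tm 1 0 [O2, O2, O12],
     tm (-1) 0 [O6, O6, O12], tm (-1) 0 [O5, O5, O12], tm 1 1 [O2, O3, O5],
     tm (-1) 0 [O5, O6, O34], tm 1 0 [O34, O56], tm 1 0 [O3, O123], tm 1 0 [O6, O345],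
     tm (-1) 1 [O5, O23], tm (-1) 0 [O1, O2]])]"

definition rules :: "rule list" where
  "rules = map (snd \<circ> snd \<circ> snd) derivation"

text \<open>No reduction below takes more steps than this.\<close>

definition fuel :: nat where
  "fuel = 64"

section \<open>Evaluation by rewriting\<close>

text \<open>
  The checks are evaluated by rewriting with defining equations. The simplifier normalizes the
  arguments of a function before it unfolds the function. Every \<open>case\<close> and \<open>if\<close> is therefore hidden
  in an auxiliary constant that receives the scrutinee as an argument and has one unconditional
  equation for each of its values: a branch is unfolded only after it has been selected, and large
  arguments such as the list of rules, once normal, are not traversed again.
\<close>

definition "cmp_of lt gt = (if lt then LT else if gt then GT else EQ)"

lemma cmp_eval:
  "cmp a b = cmp_of (a < b) (b < a)"
  "cmp_of True gt = LT" "cmp_of False True = GT" "cmp_of False False = EQ"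
  by (simp_all add: cmp_def cmp_of_def)

definition "cmp_then c d = (case c of LT \<Rightarrow> LT | GT \<Rightarrow> GT | EQ \<Rightarrow> d)"

definition "cmp_word_step c u v = (case c of LT \<Rightarrow> LT | GT \<Rightarrow> GT | EQ \<Rightarrow> cmp_word u v)"

lemma cmp_word_eval:
  "cmp_word (g # u) (h # v) = cmp_word_step (cmp_gen g h) u v"
  "cmp_word_step LT u v = LT" "cmp_word_step GT u v = GT" "cmp_word_step EQ u v = cmp_word u v"
  by (simp_all add: cmp_word_step_def)

definition "cmp_trm_step c u u' k k' =
  (case c of LT \<Rightarrow> LT | GT \<Rightarrow> GT | EQ \<Rightarrow> cmp_then (cmp_word u u') (cmp k k'))"

lemma cmp_trm_eval:
  "cmp_trm (Trm w u k c) (Trm w' u' k' c') = cmp_trm_step (cmp w w') u u' k k'"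
  "cmp_trm_step LT u u' k k' = LT" "cmp_trm_step GT u u' k k' = GT"
  "cmp_trm_step EQ u u' k k' = cmp_then (cmp_word u u') (cmp k k')"
  "cmp_then LT d = LT" "cmp_then GT d = GT" "cmp_then EQ d = d"
  by (simp_all add: cmp_trm_step_def cmp_then_def split: cmp.split)

definition "cons_nonzero z t p = (if z then p else t # p)" for p :: "trm list"

lemma cons_sum_eval:
  "cons_sum (Trm w u k c) (Trm w' u' k' c') p = cons_nonzero (c + c' = 0) (Trm w u k (c + c')) p"
  "cons_nonzero True t p = p" "cons_nonzero False t p = t # p"
  by (simp_all add: cons_sum_def cons_nonzero_def)

definition "add_terms_step d s p t q =
  (case d of GT \<Rightarrow> s # add_terms p (t # q) | LT \<Rightarrow> t # add_terms (s # p) q | EQ \<Rightarrow> cons_sum s t (add_terms p q))"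

lemma add_terms_eval:
  "add_terms (s # p) (t # q) = add_terms_step (cmp_trm s t) s p t q"
  "add_terms_step GT s p t q = s # add_terms p (t # q)" "add_terms_step LT s p t q = t # add_terms (s # p) q"
  "add_terms_step EQ s p t q = cons_sum s t (add_terms p q)"
  by (simp_all add: add_terms_step_def)

definition "mult_word_step c g u h v =
  (case c of GT \<Rightarrow> h # mult_word (g # u) v | _ \<Rightarrow> g # mult_word u (h # v))"

lemma mult_word_eval:
  "mult_word (g # u) (h # v) = mult_word_step (cmp_gen g h) g u h v"
  "mult_word_step GT g u h v = h # mult_word (g # u) v"
  "mult_word_step LT g u h v = g # mult_word u (h # v)"
  "mult_word_step EQ g u h v = g # mult_word u (h # v)"
  by (simp_all add: mult_word_step_def split: cmp.split)

definition "quot_step c g u h v =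
  (case c of GT \<Rightarrow> None | LT \<Rightarrow> map_option (Cons g) (quot u (h # v)) | EQ \<Rightarrow> quot u v)"

lemma quot_eval:
  "quot (g # u) (h # v) = quot_step (cmp_gen g h) g u h v"
  "quot_step GT g u h v = None"
  "quot_step LT g u h v = map_option (Cons g) (quot u (h # v))"
  "quot_step EQ g u h v = quot u v"
  "map_option (Cons g) None = None" "map_option (Cons g) (Some u) = Some (g # u)"
  by (simp_all add: quot_step_def)

definition "reduct_step x r G u = (case x of None \<Rightarrow> reduct G u | Some a \<Rightarrow> Some (a, r))"

lemma reduct_eval:
  "reduct ((l, r) # G) u = reduct_step (quot u l) r G u"
  "reduct_step None r G u = reduct G u" "reduct_step (Some a) r G u = Some (a, r)"
  by (simp_all add: reduct_step_def)

definition "reduces_step x G n k c p =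
  (case x of None \<Rightarrow> False
   | Some (a, r) \<Rightarrow> reduces_to_0 G n (add_terms p (scale (Trm (word_weight a) a k c) r)))"

lemma reduces_eval:
  "reduces_to_0 G (Suc n) (Trm w u k c # p) = reduces_step (reduct G u) G n k c p"
  "reduces_step None G n k c p = False"
  "reduces_step (Some (a, r)) G n k c p =
     reduces_to_0 G n (add_terms p (scale (Trm (word_weight a) a k c) r))"
  by (simp_all add: reduces_step_def)

definition "bridged_step x w u v l G =
  (case x of None \<Rightarrow> bridged w u v G | Some a \<Rightarrow> settled w u l \<and> settled w l v \<or> bridged w u v G)"
  for x :: "gen list option"

definition "bridged_or b w u v G = (b \<or> bridged w u v G)"

lemma bridged_eval:
  "bridged w u v ((l, r) # G) = bridged_step (quot w l) w u v l G"
  "bridged_step None w u v l G = bridged w u v G"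
  "bridged_step (Some a) w u v l G = bridged_or (settled w u l \<and> settled w l v) w u v G"
  "bridged_or True w u v G = True" "bridged_or False w u v G = bridged w u v G"
  by (simp_all add: bridged_step_def bridged_or_def split: option.split)

definition "pair_or1 b G n l r l' r' =
  (b \<or> bridged (lcm_word l l') l l' G \<or> reduces_to_0 G n (s_poly (l, r) (l', r')))"

definition "pair_or2 b G n l r l' r' = (b \<or> reduces_to_0 G n (s_poly (l, r) (l', r')))"

lemma pair_eval:
  "pair_ok G n (l, r) (l', r') = pair_or1 (coprime_words l l') G n l r l' r'"
  "pair_or1 True G n l r l' r' = True"
  "pair_or1 False G n l r l' r' = pair_or2 (bridged (lcm_word l l') l l' G) G n l r l' r'"
  "pair_or2 True G n l r l' r' = True"
  "pair_or2 False G n l r l' r' = reduces_to_0 G n (s_poly (l, r) (l', r'))"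
  by (simp_all add: pair_or1_def pair_or2_def)

definition "one_step_of x u = (case x of None \<Rightarrow> [tm 1 0 u] | Some (a, r) \<Rightarrow> scale (tm 1 0 a) r)"

lemma one_step_eval:
  "one_step G u = one_step_of (reduct G u) u"
  "one_step_of None u = [tm 1 0 u]" "one_step_of (Some (a, r)) u = scale (tm 1 0 a) r"
  by (simp_all add: one_step_def one_step_of_def)

lemmas fuel_eval = fuel_def[unfolded numeral_eq_Suc pred_numeral_simps BitM.simps]

lemma words_below_eval:
  "words_below n [] = True"
  "words_below n (Trm w u k c # p) = (word_weight u < n \<and> words_below n p)"
  by (simp_all add: words_below_def)

text \<open>
  Exponents of \<open>\<kappa>\<close> are calculated in unary, weights and coefficients in binary. No weight is 1, 2
  or 3, so the equations turning these three numerals into successors affect exponents only.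
\<close>

lemmas evaluation =
  cmp_eval cmp_gen_def rank.simps cmp_word.simps(1-3) cmp_word_eval cmp_trm_eval cons_sum_eval
  add_terms.simps(1,2) add_terms_eval mult_word.simps(1,2) mult_word_eval mult_trm.simps scale.simps
  quot.simps(1,2) quot_eval missing.simps remove1.simps reduct.simps(1) reduct_eval
  reduces_to_0.simps(1,2) reduces_eval s_poly_def coprime_words_def lcm_word_def settled_def
  bridged.simps(1) bridged_eval pair_eval list.pred_inject pairs_ok.simps one_step_eval overlap_def
  minus_rule_def derived.simps words_below_eval tm_def word_weight.simps gen_weight.simps
  rules_def derivation_def relation_terms_def fuel_eval list.map o_apply append.simps
  fst_conv snd_conv simp_thms if_True if_False gen.distinct list.distinct list.inject
  arith_simps rel_simps arith_special add_neg_numeral_special Num.inc.simps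
  mult_1_left mult_1_right mult_minus_left mult_minus_right add_0_left add_0_right
  add.right_inverse add.left_inverse minus_minus One_nat_def numeral_2_eq_2 numeral_3_eq_3
  add_Suc add_Suc_right Suc_less_eq zero_less_Suc not_less_zero

lemma decreasing_rules: "decreasing rules"
proof -
  have "list_all (\<lambda>(l, r). words_below (word_weight l) r) rules"
    by (simp only: evaluation prod.case)
  then show ?thesis by (auto simp: decreasing_def list_all_iff split: prod.splits)
qed

lemma derived_rules: "derived [] fuel relation_terms derivation"
  by (simp only: evaluation)

lemma relations_reduce: "list_all (reduces_to_0 rules fuel) relation_terms"
  by (simp only: evaluation)

lemma dvd_2: "list_all (\<lambda>(s, k, c, \<rho>). c dvd 2) derivation"
  by (simp add: derivation_def)

lemma pairs_rules: "pairs_ok rules fuel rules"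
  by (simp only: evaluation)


section \<open>The ideal of relations\<close>

lemma rel_ideal_0: "0 \<in> rel_ideal \<kappa>"
  using additive_subgroup.zero_closed[OF ideal.axioms(1)[OF rel_ideal_ideal[of \<kappa>]]] by simp

lemma rel_ideal_add: "f \<in> rel_ideal \<kappa> \<Longrightarrow> g \<in> rel_ideal \<kappa> \<Longrightarrow> f + g \<in> rel_ideal \<kappa>"
  using additive_subgroup.a_closed[OF ideal.axioms(1)[OF rel_ideal_ideal[of \<kappa>]], of f g] by simp

lemma rel_ideal_mult: "f \<in> rel_ideal \<kappa> \<Longrightarrow> p * f \<in> rel_ideal \<kappa>"
  using ideal.I_l_closed[OF rel_ideal_ideal[of \<kappa>], of f p] by simp

lemma rel_ideal_uminus: "f \<in> rel_ideal \<kappa> \<Longrightarrow> - f \<in> rel_ideal \<kappa>"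
  using rel_ideal_mult[of f \<kappa> "- 1"] by simp

lemma rel_ideal_diff: "f \<in> rel_ideal \<kappa> \<Longrightarrow> g \<in> rel_ideal \<kappa> \<Longrightarrow> f - g \<in> rel_ideal \<kappa>"
  using rel_ideal_add[of f \<kappa> "- g"] rel_ideal_uminus[of g] by simp

lemma relations_in_rel_ideal: "relations \<kappa> \<subseteq> rel_ideal \<kappa>"
  unfolding rel_ideal_def by (rule ring.genideal_self[OF class_ring.ring_axioms]) simp

text \<open>The universal property of the ideal, in terms of the type class operations.\<close>

lemma rel_ideal_minimal:
  assumes "relations \<kappa> \<subseteq> J" "0 \<in> J"
    and add: "\<And>f g. f \<in> J \<Longrightarrow> g \<in> J \<Longrightarrow> f + g \<in> J"
    and mult: "\<And>p f. f \<in> J \<Longrightarrow> p * f \<in> J"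
  shows "rel_ideal \<kappa> \<subseteq> J"
proof -
  have uminus: "- f \<in> J" if "f \<in> J" for f
    using mult[OF that, of "- 1"] by simp
  have "ideal J class_ring"
  proof (rule idealI)
    show "Ring.ring (class_ring :: 'a gpoly ring)" by (rule class_ring.ring_axioms)
    show "subgroup J (add_monoid (class_ring :: 'a gpoly ring))"
    proof (rule group.subgroupI)
      show group: "Group.group (add_monoid (class_ring :: 'a gpoly ring))"
        by (rule comm_group.axioms(2)[OF abelian_group.a_comm_group]) unfold_locales
      show "inv\<^bsub>add_monoid class_ring\<^esub> f \<in> J" if "f \<in> J" for f
      proof -
        have "inv\<^bsub>add_monoid class_ring\<^esub> f = - f"
          by (rule group.inv_equality[OF group]) auto
        then show ?thesis using uminus[OF that] by (simp only:)
      qed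
    qed (use assms in auto)
  qed (use mult in \<open>auto simp: mult.commute\<close>)
  then show ?thesis
    unfolding rel_ideal_def
    by (rule ring.genideal_minimal[OF class_ring.ring_axioms _ assms(1)])
qed

lemma below_subset_rel_ideal:
  assumes "\<And>\<rho>. \<rho> \<in> set G \<Longrightarrow> rule_poly \<kappa> \<rho> \<in> rel_ideal \<kappa>" "f \<in> below \<kappa> G n"
  shows "f \<in> rel_ideal \<kappa>"
  using assms(2)
  by induction (auto intro: rel_ideal_0 rel_ideal_add rel_ideal_mult assms(1))

text \<open>
  The scalars by which the derivation divides are products of \<open>\<kappa>\<close>, 2 and \<open>- 1\<close>, so these have to be
  units in the field.
\<close>

locale unit_kappa =
  fixes \<kappa> :: "'k::field"
  assumes kappa: "\<kappa> \<noteq> 0" and two: "(2 :: 'k) \<noteq> 0"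
begin

lemma val_relation_terms:
  "map (val \<kappa>) relation_terms =
     [rel_a \<kappa> 1, rel_a \<kappa> 2, rel_a \<kappa> 3, rel_a \<kappa> 4, rel_a \<kappa> 5, rel_a \<kappa> 6,
      rel_b \<kappa> 1, rel_b \<kappa> 2, rel_b \<kappa> 3, rel_b \<kappa> 4, rel_b \<kappa> 5, rel_b \<kappa> 6,
      rel_c \<kappa> 4, rel_c \<kappa> 5, rel_c \<kappa> 6, rel_c \<kappa> 1, rel_c \<kappa> 2, rel_c \<kappa> 3, const 2 * rel_d \<kappa>]"
proof -
  have vars: "oo1 0 = var O6" "oo1 (Suc 0) = var O1" "oo1 2 = var O2" "oo1 3 = var O3" "oo1 4 = var O4"
    "oo1 5 = var O5" "oo1 6 = var O6" "oo1 7 = var O1" "oo1 8 = var O2" "oo1 9 = var O3"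
    "oo1 10 = var O4" "oo1 11 = var O5"
    "oo2 0 = var O61" "oo2 (Suc 0) = var O12" "oo2 2 = var O23" "oo2 3 = var O34" "oo2 4 = var O45"
    "oo2 5 = var O56" "oo2 6 = var O61" "oo2 7 = var O12" "oo2 8 = var O23" "oo2 9 = var O34"
    "oo2 10 = var O45" "oo2 11 = var O56"
    "oo3 0 = var O345" "oo3 (Suc 0) = var O123" "oo3 2 = var O234" "oo3 3 = var O345" "oo3 4 = var O123"
    "oo3 5 = var O234" "oo3 6 = var O345" "oo3 7 = var O123" "oo3 8 = var O234" "oo3 9 = var O345"
    by (simp_all add: oo1_def oo2_def oo3_def)
  \<comment> \<open>The simplifier turns small sums of indices into successors.\<close>
  have vars_Suc: "oo1 (Suc (Suc 0)) = var O2" "oo1 (Suc (Suc (Suc 0))) = var O3"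
    "oo2 (Suc (Suc 0)) = var O23" "oo2 (Suc (Suc (Suc 0))) = var O34"
    "oo3 (Suc (Suc 0)) = var O234" "oo3 (Suc (Suc (Suc 0))) = var O345"
    by (simp_all add: oo1_def oo2_def oo3_def)
  have val: "trm_val \<kappa> (tm c k u) = const (of_int c) * const \<kappa> ^ k * prod_list (map var u)" for c k u
  proof -
    have "prod_list (map var u) = (Poly_Mapping.single (monom_of u) 1 :: 'k gpoly)"
      by (induction u) (simp_all add: var_def mult_single)
    moreover have "const \<kappa> ^ k = const (\<kappa> ^ k)"
      by (induction k) (simp_all add: const_mult const_1)
    ultimately show ?thesis
      by (simp add: trm_val_def tm_def const_def mult_single del: single_of_int)
  qed
  have half: "2 * const (\<kappa> / 2) = const \<kappa>" 
  proof -
    have "2 * const (\<kappa> / 2) = const (\<kappa> / 2) + const (\<kappa> / 2)" by simp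
    also have "\<dots> = const \<kappa>" using two by (simp add: const_add[symmetric] field_simps)
    finally show ?thesis .
  qed
  have const_simps: "const 1 = (1 :: 'k gpoly)" "const (- 1) = (- 1 :: 'k gpoly)" "const 2 = (2 :: 'k gpoly)"
    "const (- 2) = (- 2 :: 'k gpoly)" "const (\<kappa> ^ 3) = const \<kappa> ^ 3"
    by (simp_all add: const_def single_uminus mult_single eval_nat_numeral)
  have d: "2 * rel_d \<kappa> =
     2 * (var O123 * var O234 * var O345)
     - 2 * (var O1 * var O4 * var O345 + var O2 * var O5 * var O123 + var O3 * var O6 * var O234)
     + const \<kappa> *
         (var O1 * var O6 * var O61 + var O2 * var O1 * var O12 + var O3 * var O2 * var O23
          + var O4 * var O3 * var O34 + var O5 * var O4 * var O45 + var O6 * var O5 * var O56)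
     - 2 * (var O1 * var O3 * var O5 + var O2 * var O4 * var O6)
     - const \<kappa> *
         ((var O12)^2 + (var O23)^2 + (var O34)^2 + (var O45)^2 + (var O56)^2 + (var O61)^2)
     + 2 * const \<kappa> ^ 3"
    unfolding rel_d_def half[symmetric] const_simps(5) by (simp only: distrib_left right_diff_distrib mult.assoc)
  show ?thesis
    unfolding relation_terms_def const_simps d
    by (simp add: val const_simps rel_a_def rel_b_def rel_c_def vars vars_Suc algebra_simps power2_eq_square)
qed

lemma relation_terms_in_rel_ideal:
  assumes "p \<in> set relation_terms"
  shows "val \<kappa> p \<in> rel_ideal \<kappa>"
proof -
  have r: "rel_a \<kappa> i \<in> rel_ideal \<kappa>" "rel_b \<kappa> i \<in> rel_ideal \<kappa>" "rel_c \<kappa> i \<in> rel_ideal \<kappa>"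
    if "i \<in> {1..6}" for i
    using that relations_in_rel_ideal[of \<kappa>] unfolding relations_def by blast+
  have d: "rel_d \<kappa> \<in> rel_ideal \<kappa>"
    using relations_in_rel_ideal[of \<kappa>] unfolding relations_def by blast
  have "val \<kappa> p \<in> set (map (val \<kappa>) relation_terms)" using assms by simp
  then show ?thesis
    unfolding val_relation_terms by (auto simp: r d rel_ideal_mult simp del: One_nat_def)
qed

lemma relation_from_terms:
  assumes "f \<in> relations \<kappa>"
  shows "\<exists>p\<in>set relation_terms. \<exists>c. f = const c * val \<kappa> p"
proof -
  have "{1..6::nat} = {1, 2, 3, 4, 5, 6}" by auto
  then have "f \<in> set (map (val \<kappa>) relation_terms) \<or> f = rel_d \<kappa>"
    using assms unfolding relations_def val_relation_terms by auto
  then show ?thesis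
  proof
    assume "f \<in> set (map (val \<kappa>) relation_terms)"
    then show ?thesis by (auto intro!: exI[of _ 1] simp: const_1)
  next
    assume f: "f = rel_d \<kappa>"
    have "const 2 * rel_d \<kappa> \<in> set (map (val \<kappa>) relation_terms)"
      unfolding val_relation_terms by simp
    then obtain p where p: "p \<in> set relation_terms" "val \<kappa> p = const 2 * rel_d \<kappa>" by auto
    have "f = const (1 / 2) * val \<kappa> p"
      unfolding p f mult.assoc[symmetric] const_mult[symmetric] using two by (simp add: const_1)
    with p(1) show ?thesis by blast
  qed
qed

lemma val_one_step:
  assumes "decreasing G" "\<And>\<rho>. \<rho> \<in> set G \<Longrightarrow> rule_poly \<kappa> \<rho> \<in> rel_ideal \<kappa>"
  shows "rule_poly \<kappa> (u, one_step G u) \<in> rel_ideal \<kappa>"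
proof (cases "reduct G u")
  case None
  then show ?thesis by (simp add: rule_poly_def one_step_def trm_val_def tm_def rel_ideal_0)
next
  case (Some x)
  then obtain a r where "reduct G u = Some (a, r)" by (cases x) auto
  then show ?thesis
    using below_subset_rel_ideal[OF assms(2) reduct_below(1)[OF assms(1), of u a r 1]]
    by (simp add: rule_poly_def one_step_def val_scale trm_val_def tm_def)
qed

lemma val_minus_rule:
  "val \<kappa> (minus_rule p k c \<rho>) = val \<kappa> p - const (of_int c * \<kappa> ^ k) * rule_poly \<kappa> \<rho>"
  by (simp add: minus_rule_def val_add_terms val_scale trm_val_def tm_def rule_poly_def const_def
      right_diff_distrib mult_single single_uminus)

text \<open>
  What the reduction subtracts lies in the ideal, so the multiple of the rule does, and the scalar
  is a unit.
\<close>

lemma rule_poly_in_rel_ideal: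
  assumes "decreasing G" "\<And>\<rho>. \<rho> \<in> set G \<Longrightarrow> rule_poly \<kappa> \<rho> \<in> rel_ideal \<kappa>"
    and "val \<kappa> p \<in> rel_ideal \<kappa>" "c dvd 2" "reduces_to_0 G n (minus_rule p k c \<rho>)"
  shows "rule_poly \<kappa> \<rho> \<in> rel_ideal \<kappa>"
proof -
  let ?u = "of_int c * \<kappa> ^ k"
  have u: "?u \<noteq> 0"
  proof -
    obtain e where "2 = c * e" using assms(4) by blast
    then have "of_int c * of_int e = (2 :: 'k)"
      by (metis of_int_mult of_int_numeral)
    then show ?thesis using two kappa by auto
  qed
  obtain N where "words_below N (minus_rule p k c \<rho>)" using ex_words_below by blast
  from reduces_to_0_below[OF assms(1,5) this, of \<kappa>]
  have "val \<kappa> (minus_rule p k c \<rho>) \<in> rel_ideal \<kappa>"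
    using below_subset_rel_ideal assms(2) by blast
  from rel_ideal_diff[OF assms(3) this]
  have "const (inverse ?u) * (const ?u * rule_poly \<kappa> \<rho>) \<in> rel_ideal \<kappa>"
    by (intro rel_ideal_mult[of "const ?u * rule_poly \<kappa> \<rho>"]) (simp add: val_minus_rule)
  moreover have "const (inverse ?u) * (const ?u * rule_poly \<kappa> \<rho>) = rule_poly \<kappa> \<rho>"
  proof -
    have "const (inverse x) * const x = (1 :: 'k gpoly)" if "x \<noteq> 0" for x :: 'k
      unfolding const_mult[symmetric] using that by (simp add: const_1)
    from this[OF u] show ?thesis by (simp only: mult.assoc[symmetric] mult_1_left)
  qed
  ultimately show ?thesis by simp
qed

lemma derived_in_rel_ideal:
  assumes "derived G n R D" "decreasing G" "\<And>\<rho>. \<rho> \<in> set G \<Longrightarrow> rule_poly \<kappa> \<rho> \<in> rel_ideal \<kappa>"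
    and "\<And>p. p \<in> set R \<Longrightarrow> val \<kappa> p \<in> rel_ideal \<kappa>"
    and "\<And>s k c \<rho>. (s, k, c, \<rho>) \<in> set D \<Longrightarrow> c dvd 2 \<and> words_below (word_weight (fst \<rho>)) (snd \<rho>)"
    and "(s, k, c, \<rho>) \<in> set D"
  shows "rule_poly \<kappa> \<rho> \<in> rel_ideal \<kappa>"
  using assms
proof (induction G n R D rule: derived.induct)
  case (3 G n p R k' c' \<rho>' D)
  have step: "c' dvd 2" "words_below (word_weight (fst \<rho>')) (snd \<rho>')"
    using "3.prems"(5)[of Relation k' c' \<rho>'] by simp_all
  have new: "rule_poly \<kappa> \<rho>' \<in> rel_ideal \<kappa>"
    by (rule rule_poly_in_rel_ideal[OF "3.prems"(2,3), where p = p and c = c' and k = k' and n = n])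
      (use "3.prems" step in auto)
  have dec: "decreasing (G @ [\<rho>'])"
    using "3.prems"(2) step by (auto simp: decreasing_def)
  have G: "rule_poly \<kappa> \<sigma> \<in> rel_ideal \<kappa>" if "\<sigma> \<in> set (G @ [\<rho>'])" for \<sigma>
    using that new "3.prems"(3)[of \<sigma>] by (cases "\<sigma> = \<rho>'") simp_all
  have D: "c dvd 2 \<and> words_below (word_weight (fst \<rho>)) (snd \<rho>)"
    if "(s, k, c, \<rho>) \<in> set D" for s k c \<rho>
    using "3.prems"(5) that by (meson list.set_intros(2))
  show ?case
  proof (cases "(s, k, c, \<rho>) \<in> set D")
    case True
    show ?thesis
      by (rule "3.IH"[OF _ dec G _ D True]) (use "3.prems"(1,4) in auto)
  next
    case False
    then show ?thesis using "3.prems"(6) new by simp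
  qed
next
  case (4 G n R u v k' c' \<rho>' D)
  have "val \<kappa> (overlap G u v) \<in> rel_ideal \<kappa>"
    unfolding overlap_def val_s_poly fst_conv
    by (intro rel_ideal_diff rel_ideal_mult val_one_step "4.prems"(2,3))
  moreover have step: "c' dvd 2" "words_below (word_weight (fst \<rho>')) (snd \<rho>')"
    using "4.prems"(5)[of "Overlap u v" k' c' \<rho>'] by simp_all
  ultimately have new: "rule_poly \<kappa> \<rho>' \<in> rel_ideal \<kappa>"
    by (intro rule_poly_in_rel_ideal[OF "4.prems"(2,3), where c = c' and k = k' and n = n])
      (use "4.prems" step in auto)
  have dec: "decreasing (G @ [\<rho>'])"
    using "4.prems"(2) step by (auto simp: decreasing_def)
  have G: "rule_poly \<kappa> \<sigma> \<in> rel_ideal \<kappa>" if "\<sigma> \<in> set (G @ [\<rho>'])" for \<sigma>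
    using that new "4.prems"(3)[of \<sigma>] by (cases "\<sigma> = \<rho>'") simp_all
  have D: "c dvd 2 \<and> words_below (word_weight (fst \<rho>)) (snd \<rho>)"
    if "(s, k, c, \<rho>) \<in> set D" for s k c \<rho>
    using "4.prems"(5) that by (meson list.set_intros(2))
  show ?case
  proof (cases "(s, k, c, \<rho>) \<in> set D")
    case True
    show ?thesis
      by (rule "4.IH"[OF _ dec G _ D True]) (use "4.prems"(1,4) in auto)
  next
    case False
    then show ?thesis using "4.prems"(6) new by simp
  qed
qed auto

lemma rules_in_rel_ideal: "\<rho> \<in> set rules \<Longrightarrow> rule_poly \<kappa> \<rho> \<in> rel_ideal \<kappa>"
proof -
  assume "\<rho> \<in> set rules"
  then obtain s k c where "(s, k, c, \<rho>) \<in> set derivation"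
    by (auto simp: rules_def)
  moreover have "c dvd 2 \<and> words_below (word_weight (fst \<rho>)) (snd \<rho>)"
    if "(s, k, c, \<rho>) \<in> set derivation" for s k c \<rho>
  proof -
    have "\<rho> \<in> set rules" using that by (force simp: rules_def)
    then show ?thesis
      using decreasing_rules that dvd_2 by (auto simp: decreasing_def list_all_iff)
  qed
  ultimately show ?thesis
    using derived_in_rel_ideal[OF derived_rules] relation_terms_in_rel_ideal
    by (auto simp: decreasing_def)
qed

text \<open>
  The rules generate the whole ideal, because the relations reduce to 0 modulo the rules.
\<close>

lemma rel_ideal_below:
  assumes "f \<in> rel_ideal \<kappa>"
  shows "\<exists>n. f \<in> below \<kappa> rules n"
proof -
  let ?J = "{f. \<exists>n. f \<in> below \<kappa> rules n}"
  have add: "f + g \<in> ?J" if "f \<in> ?J" "g \<in> ?J" for f g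
  proof -
    from that obtain m n where "f \<in> below \<kappa> rules m" "g \<in> below \<kappa> rules n" by auto
    then have "f + g \<in> below \<kappa> rules (max m n)"
      by (intro below_add) (auto elim: below_mono)
    then show ?thesis by blast
  qed
  have single: "Poly_Mapping.single a c * f \<in> ?J" if "f \<in> ?J" for a c f
    using that below_single_mult by blast
  have mult: "p * f \<in> ?J" if "f \<in> ?J" for p f
  proof (induction p rule: update_induct)
    case const
    then show ?case by (auto intro: below.zero)
  next
    case (update q a c)
    have "Poly_Mapping.update a c q = q + Poly_Mapping.single a c"
      using update.hyps by (simp add: update_eq_add)
    then show ?case
      using add[OF update.IH single[OF that]] by (simp add: distrib_right)
  qed
  have "relations \<kappa> \<subseteq> ?J"
  proof
    fix g assume "g \<in> relations \<kappa>"
    then obtain p c where p: "p \<in> set relation_terms" "g = const c * val \<kappa> p"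
      using relation_from_terms by blast
    obtain N where "words_below N p" using ex_words_below by blast
    moreover have "reduces_to_0 rules fuel p"
      using relations_reduce p(1) by (simp add: list_all_iff)
    ultimately have "val \<kappa> p \<in> ?J"
      using reduces_to_0_below[OF decreasing_rules] by blast
    then show "g \<in> ?J" unfolding p(2) by (rule mult)
  qed
  then have "rel_ideal \<kappa> \<subseteq> ?J"
    by (rule rel_ideal_minimal) (use add mult in \<open>auto intro: below.zero\<close>)
  then show ?thesis using assms by blast
qed

lemma irreducible_rel_ideal_0:
  assumes "f \<in> rel_ideal \<kappa>" "\<And>m. m \<in> Poly_Mapping.keys f \<Longrightarrow> \<not> reducible rules m"
  shows "f = 0"
  using rel_ideal_below[OF assms(1)] below_irreducible_0[OF decreasing_rules buchberger[OF decreasing_rules pairs_rules] _ assms(2)]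
  by blast

end


section \<open>Normal forms\<close>

definition normal_monomials :: "monomial set" where
  "normal_monomials = {m. \<not> reducible rules m}"

definition normal_terms :: "trm list \<Rightarrow> bool" where
  "normal_terms p \<longleftrightarrow> (\<forall>t\<in>set p. monom_of (trm_word t) \<in> normal_monomials)"

lemma keys_val_normal:
  assumes "normal_terms p"
  shows "Poly_Mapping.keys (val \<kappa> p) \<subseteq> normal_monomials"
  using assms
proof (induction p)
  case (Cons t p)
  have "Poly_Mapping.keys (trm_val \<kappa> t) \<subseteq> {monom_of (trm_word t)}"
    by (simp add: trm_val_def)
  then show ?case
    using Cons keys_add[of "trm_val \<kappa> t" "val \<kappa> p"] by (auto simp: normal_terms_def)
qed simp

text \<open>
  Two fields are treated at the same time because no formula quantifies over fields: what matters is
  that one and the same term list over \<open>\<int>[\<kappa>]\<close> is a normal form in both quotients.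
\<close>

context
  fixes \<kappa> :: "'a::field" and \<kappa>' :: "'b::field"
  assumes units: "unit_kappa \<kappa>" "unit_kappa \<kappa>'"
begin

definition joint_normal_form :: "'a gpoly \<Rightarrow> 'b gpoly \<Rightarrow> trm list \<Rightarrow> bool" where
  "joint_normal_form f f' p \<longleftrightarrow>
     normal_terms p \<and> f - val \<kappa> p \<in> rel_ideal \<kappa> \<and> f' - val \<kappa>' p \<in> rel_ideal \<kappa>'"

lemma joint_normal_form_val:
  assumes "\<And>t. t \<in> set r \<Longrightarrow> \<exists>p. joint_normal_form (mono_poly (a + monom_of (trm_word t))) (mono_poly (a + monom_of (trm_word t))) p"
  shows "\<exists>p. joint_normal_form (mono_poly a * val \<kappa> r) (mono_poly a * val \<kappa>' r) p"
  using assms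
proof (induction r)
  case Nil
  show ?case
    by (rule exI[of _ "[]"]) (simp add: joint_normal_form_def normal_terms_def rel_ideal_0)
next
  case (Cons t r)
  let ?m = "a + monom_of (trm_word t)"
  obtain p where p: "joint_normal_form (mono_poly a * val \<kappa> r) (mono_poly a * val \<kappa>' r) p"
    using Cons by auto
  obtain q where q: "joint_normal_form (mono_poly ?m) (mono_poly ?m) q"
    using Cons.prems[of t] by auto
  let ?q = "scale (tm (trm_coeff t) (trm_exp t) []) q"
  have normal: "normal_terms (?q @ p)"
  proof -
    have "trm_word (mult_trm (tm c k []) s) = trm_word s" for c k s
      by (cases s) (simp add: tm_def)
    then have "normal_terms (scale (tm c k []) s)" if "normal_terms s" for c k s
      using that by (induction s) (auto simp: normal_terms_def)
    then show ?thesis using p q by (auto simp: joint_normal_form_def normal_terms_def)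
  qed
  have *: "mono_poly a * val x (t # r) - val x (?q @ p) \<in> rel_ideal x"
    if "mono_poly a * val x r - val x p \<in> rel_ideal x" "mono_poly ?m - val x q \<in> rel_ideal x"
    for x :: "'c::field"
  proof -
    let ?c = "of_int (trm_coeff t) * x ^ trm_exp t"
    have "mono_poly a * val x (t # r) - val x (?q @ p)
        = Poly_Mapping.single 0 ?c * (mono_poly ?m - val x q) + (mono_poly a * val x r - val x p)"
      by (simp add: val_append val_scale trm_val_def tm_def mono_poly_def algebra_simps mult_single)
    then show ?thesis using that by (simp add: rel_ideal_add rel_ideal_mult)
  qed
  show ?case
    using normal *[of \<kappa>] *[of \<kappa>'] p q unfolding joint_normal_form_def by blast
qed

lemma joint_normal_form_monomial: "\<exists>p. joint_normal_form (mono_poly m) (mono_poly m) p"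
proof (induction "weight m" arbitrary: m rule: less_induct)
  case less
  show ?case
  proof (cases "m \<in> normal_monomials")
    case True
    obtain u where u: "m = monom_of u" using ex_word by blast
    have val: "val x [tm 1 0 u] = mono_poly m" for x :: "'c::field"
      by (simp add: trm_val_def tm_def mono_poly_def u)
    have "normal_terms [tm 1 0 u]"
      using True by (simp add: normal_terms_def tm_def u)
    then have "joint_normal_form (mono_poly m) (mono_poly m) [tm 1 0 u]"
      by (simp add: joint_normal_form_def rel_ideal_0 val[of \<kappa>] val[of \<kappa>'] del: val_simps)
    then show ?thesis by blast
  next
    case False
    then obtain \<rho> a where \<rho>: "\<rho> \<in> set rules" "m = a + monom_of (fst \<rho>)"
      by (auto simp: normal_monomials_def reducible_def)
    have "weight (a + monom_of (trm_word t)) < weight m" if "t \<in> set (snd \<rho>)" for t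
      using decreasing_rules \<rho> that
      by (auto simp: decreasing_def words_below_def weight_add weight_monom_of)
    then obtain p where p: "joint_normal_form (mono_poly a * val \<kappa> (snd \<rho>)) (mono_poly a * val \<kappa>' (snd \<rho>)) p"
      using joint_normal_form_val[of "snd \<rho>" a] less by blast
    have *: "mono_poly m - val x p \<in> rel_ideal x"
      if "unit_kappa x" "mono_poly a * val x (snd \<rho>) - val x p \<in> rel_ideal x" for x :: "'c::field"
    proof -
      have "mono_poly m - val x p
          = mono_poly a * rule_poly x \<rho> + (mono_poly a * val x (snd \<rho>) - val x p)"
        by (simp add: rule_poly_def mono_poly_def \<rho>(2) algebra_simps mult_single)
      then show ?thesis
        using rel_ideal_add[OF rel_ideal_mult[OF unit_kappa.rules_in_rel_ideal[OF that(1) \<rho>(1)]] that(2)]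
        by (simp only:)
    qed
    then show ?thesis
      using p units *[of \<kappa>] *[of \<kappa>'] unfolding joint_normal_form_def by blast
  qed
qed

end

lemma sum_keys_mono_poly: "f = (\<Sum>m\<in>Poly_Mapping.keys f. const (Poly_Mapping.lookup f m) * mono_poly m)"
proof (rule poly_mapping_eqI)
  fix n
  have "Poly_Mapping.lookup (\<Sum>m\<in>Poly_Mapping.keys f. const (Poly_Mapping.lookup f m) * mono_poly m) n
      = (\<Sum>m\<in>Poly_Mapping.keys f. if m = n then Poly_Mapping.lookup f m else 0)"
    unfolding lookup_sum
    by (intro sum.cong) (auto simp: const_def mono_poly_def mult_single lookup_single when_def)
  then show "Poly_Mapping.lookup f n = Poly_Mapping.lookup (\<Sum>m\<in>Poly_Mapping.keys f. const (Poly_Mapping.lookup f m) * mono_poly m) n"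
    by (simp add: in_keys_iff)
qed

context unit_kappa
begin

lemma ex_normal_form:
  "\<exists>f. Poly_Mapping.keys f \<subseteq> normal_monomials \<and> p - f \<in> rel_ideal \<kappa>"
proof (induction p rule: update_induct)
  case const
  show ?case by (rule exI[of _ 0]) (simp add: rel_ideal_0)
next
  case (update p m c)
  then obtain f where f: "Poly_Mapping.keys f \<subseteq> normal_monomials" "p - f \<in> rel_ideal \<kappa>" by auto
  have unit: "unit_kappa \<kappa>" by unfold_locales
  obtain q where q: "normal_terms q" "mono_poly m - val \<kappa> q \<in> rel_ideal \<kappa>"
    using joint_normal_form_monomial[OF unit unit, of m]
    unfolding joint_normal_form_def[OF unit unit] by blast
  have eq: "Poly_Mapping.update m c p = p + Poly_Mapping.single m c"
    using update.hyps by (simp add: update_eq_add)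
  have "Poly_Mapping.update m c p - (f + const c * val \<kappa> q) = (p - f) + const c * (mono_poly m - val \<kappa> q)"
    by (simp add: eq const_def mono_poly_def algebra_simps mult_single)
  then have "Poly_Mapping.update m c p - (f + const c * val \<kappa> q) \<in> rel_ideal \<kappa>"
    using rel_ideal_add[OF f(2) rel_ideal_mult[OF q(2), of "const c"]] by (simp only:)
  moreover have "Poly_Mapping.keys (const c * val \<kappa> q) \<subseteq> Poly_Mapping.keys (val \<kappa> q)"
  proof
    fix n assume "n \<in> Poly_Mapping.keys (const c * val \<kappa> q)"
    then show "n \<in> Poly_Mapping.keys (val \<kappa> q)"
      by (auto simp: in_keys_iff const_def lookup_single_mult)
  qed
  then have "Poly_Mapping.keys (f + const c * val \<kappa> q) \<subseteq> normal_monomials"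
    using f(1) keys_val_normal[OF q(1), of \<kappa>] keys_add[of f "const c * val \<kappa> q"] by blast
  ultimately show ?case by blast
qed

section \<open>The basis of normal monomials\<close>

lemma cls_eq_iff: "cls \<kappa> p = cls \<kappa> q \<longleftrightarrow> p - q \<in> rel_ideal \<kappa>"
proof -
  have cls: "cls \<kappa> r = {h + r |h. h \<in> rel_ideal \<kappa>}" for r
    unfolding cls_def a_r_coset_def' by auto
  show ?thesis
  proof
    assume "cls \<kappa> p = cls \<kappa> q"
    moreover have "p \<in> cls \<kappa> p" unfolding cls using rel_ideal_0 by force
    ultimately obtain h where "p = h + q" "h \<in> rel_ideal \<kappa>" unfolding cls by blast
    then show "p - q \<in> rel_ideal \<kappa>" by simp
  next
    assume *: "p - q \<in> rel_ideal \<kappa>"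
    have "h + p \<in> cls \<kappa> q" if "h \<in> rel_ideal \<kappa>" for h
    proof -
      have "h + p = (h + (p - q)) + q" by simp
      then show ?thesis unfolding cls using rel_ideal_add[OF that *] by blast
    qed
    moreover have "h + q \<in> cls \<kappa> p" if "h \<in> rel_ideal \<kappa>" for h
    proof -
      have "h + q = (h - (p - q)) + p" by simp
      then show ?thesis unfolding cls using rel_ideal_diff[OF that *] by blast
    qed
    ultimately show "cls \<kappa> p = cls \<kappa> q" unfolding cls[of p] cls[of q] unfolding cls by auto
  qed
qed

interpretation V: vectorspace class_ring "genus2_alg \<kappa>"
  by (rule genus2_alg_vectorspace)

interpretation cls: ring_hom_ring class_ring "class_ring Quot rel_ideal \<kappa>" "cls \<kappa>"
  unfolding cls_def[abs_def] by (rule ideal.rcos_ring_hom_ring[OF rel_ideal_ideal])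

lemma carrier_genus2_alg: "carrier (genus2_alg \<kappa>) = range (cls \<kappa>)"
  by (auto simp: genus2_alg_def Let_def FactRing_def A_RCOSETS_def' cls_def)

lemma cls_add: "cls \<kappa> p \<oplus>\<^bsub>genus2_alg \<kappa>\<^esub> cls \<kappa> q = cls \<kappa> (p + q)"
  using cls.hom_add[of p q] by (simp add: genus2_alg_def Let_def)

lemma cls_mult: "cls \<kappa> p \<otimes>\<^bsub>genus2_alg \<kappa>\<^esub> cls \<kappa> q = cls \<kappa> (p * q)"
  using cls.hom_mult[of p q] by (simp add: genus2_alg_def Let_def)

lemma cls_smult: "c \<odot>\<^bsub>genus2_alg \<kappa>\<^esub> cls \<kappa> q = cls \<kappa> (const c * q)"
  using cls.hom_mult[of "const c" q] by (simp add: genus2_alg_def Let_def)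

lemma cls_0: "\<zero>\<^bsub>genus2_alg \<kappa>\<^esub> = cls \<kappa> 0"
proof -
  have "cls \<kappa> 0 \<oplus>\<^bsub>genus2_alg \<kappa>\<^esub> cls \<kappa> 0 = cls \<kappa> 0" by (simp add: cls_add)
  then show ?thesis
    using V.M.add.l_cancel_one[of "cls \<kappa> 0" "cls \<kappa> 0"] by (simp add: carrier_genus2_alg)
qed

lemma finsum_cls:
  assumes "finite A"
  shows "(\<Oplus>\<^bsub>genus2_alg \<kappa>\<^esub>x\<in>A. cls \<kappa> (h x)) = cls \<kappa> (sum h A)"
  using assms by induction (auto simp: cls_0 carrier_genus2_alg cls_add)

lemma lincomb_cls:
  assumes "finite A" "inj_on (\<lambda>b. cls \<kappa> (mono_poly b)) A"
  shows "V.lincomb a ((\<lambda>b. cls \<kappa> (mono_poly b)) ` A) =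
    cls \<kappa> (\<Sum>b\<in>A. const (a (cls \<kappa> (mono_poly b))) * mono_poly b)"
proof -
  have "V.lincomb a ((\<lambda>b. cls \<kappa> (mono_poly b)) ` A) =
      (\<Oplus>\<^bsub>genus2_alg \<kappa>\<^esub>b\<in>A. a (cls \<kappa> (mono_poly b)) \<odot>\<^bsub>genus2_alg \<kappa>\<^esub> cls \<kappa> (mono_poly b))"
    unfolding V.lincomb_def
    by (rule V.M.finsum_reindex) (use assms in \<open>auto simp: cls_smult carrier_genus2_alg\<close>)
  then show ?thesis by (simp add: cls_smult finsum_cls[OF assms(1)])
qed

text \<open>Normal forms are unique, which is where Buchberger's criterion enters.\<close>

lemma normal_form_unique:
  assumes "cls \<kappa> f = cls \<kappa> g" "Poly_Mapping.keys f \<subseteq> normal_monomials"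
    "Poly_Mapping.keys g \<subseteq> normal_monomials"
  shows "f = g"
proof -
  have "Poly_Mapping.keys (f - g) \<subseteq> normal_monomials"
    using assms(2,3) keys_diff[of f g] by blast
  then have "f - g = 0"
    using assms(1) irreducible_rel_ideal_0[of "f - g"]
    by (auto simp: cls_eq_iff normal_monomials_def)
  then show ?thesis by simp
qed

lemma inj_on_normal: "inj_on (\<lambda>b. cls \<kappa> (mono_poly b)) normal_monomials"
proof (rule inj_onI)
  fix m n assume mn: "m \<in> normal_monomials" "n \<in> normal_monomials"
    and eq: "cls \<kappa> (mono_poly m) = cls \<kappa> (mono_poly n)"
  have "mono_poly m = (mono_poly n :: 'k gpoly)"
    by (rule normal_form_unique[OF eq]) (use mn in \<open>auto simp: mono_poly_def\<close>)
  then show "m = n"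
    by (metis keys_single mono_poly_def singleton_inject zero_neq_one)
qed

abbreviation basis_classes :: "'k gpoly set set" where
  "basis_classes \<equiv> (\<lambda>b. cls \<kappa> (mono_poly b)) ` normal_monomials"

definition normal_coeff :: "'k gpoly \<Rightarrow> 'k gpoly set \<Rightarrow> 'k" where
  "normal_coeff f v =
     (if v \<in> basis_classes
      then Poly_Mapping.lookup f (the_inv_into normal_monomials (\<lambda>b. cls \<kappa> (mono_poly b)) v) else 0)"

lemma normal_coeff_cls:
  "m \<in> normal_monomials \<Longrightarrow> normal_coeff f (cls \<kappa> (mono_poly m)) = Poly_Mapping.lookup f m"
  by (simp add: normal_coeff_def the_inv_into_f_f[OF inj_on_normal])

lemma normal_coeff_support:
  assumes "Poly_Mapping.keys f \<subseteq> normal_monomials"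
  shows "{v. normal_coeff f v \<noteq> 0} = (\<lambda>b. cls \<kappa> (mono_poly b)) ` Poly_Mapping.keys f"
proof -
  have "v \<in> (\<lambda>b. cls \<kappa> (mono_poly b)) ` Poly_Mapping.keys f" if "normal_coeff f v \<noteq> 0" for v
  proof -
    from that obtain m where "m \<in> normal_monomials" "v = cls \<kappa> (mono_poly m)"
      by (auto simp: normal_coeff_def split: if_splits)
    then show ?thesis using that by (auto simp: normal_coeff_cls in_keys_iff)
  qed
  then show ?thesis using assms by (auto simp: normal_coeff_cls in_keys_iff)
qed

lemma lincomb_normal_coeff:
  assumes "Poly_Mapping.keys f \<subseteq> normal_monomials"
  shows "V.lincomb (normal_coeff f) {v. normal_coeff f v \<noteq> 0} = cls \<kappa> f"
proof -
  have "V.lincomb (normal_coeff f) {v. normal_coeff f v \<noteq> 0} =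
      cls \<kappa> (\<Sum>b\<in>Poly_Mapping.keys f. const (normal_coeff f (cls \<kappa> (mono_poly b))) * mono_poly b)"
    unfolding normal_coeff_support[OF assms]
    by (rule lincomb_cls) (use inj_on_subset[OF inj_on_normal assms] in auto)
  also have "(\<Sum>b\<in>Poly_Mapping.keys f. const (normal_coeff f (cls \<kappa> (mono_poly b))) * mono_poly b) = f"
    using assms by (subst (3) sum_keys_mono_poly) (intro sum.cong, auto simp: normal_coeff_cls)
  finally show ?thesis .
qed

lemma normal_basis: "V.basis basis_classes"
  unfolding V.basis_def
proof (intro conjI)
  show sub: "basis_classes \<subseteq> carrier (genus2_alg \<kappa>)"
    by (auto simp: carrier_genus2_alg)
  show "V.span basis_classes = carrier (genus2_alg \<kappa>)"
  proof
    show "V.span basis_classes \<subseteq> carrier (genus2_alg \<kappa>)"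
      by (rule V.span_is_subset2[OF sub])
    show "carrier (genus2_alg \<kappa>) \<subseteq> V.span basis_classes"
    proof
      fix x assume "x \<in> carrier (genus2_alg \<kappa>)"
      then obtain p where "x = cls \<kappa> p" by (auto simp: carrier_genus2_alg)
      moreover obtain f where f: "Poly_Mapping.keys f \<subseteq> normal_monomials" "p - f \<in> rel_ideal \<kappa>"
        using ex_normal_form by blast
      ultimately have "x = V.lincomb (normal_coeff f) {v. normal_coeff f v \<noteq> 0}"
        by (simp add: lincomb_normal_coeff cls_eq_iff)
      moreover have "{v. normal_coeff f v \<noteq> 0} \<subseteq> basis_classes"
        using f(1) by (auto simp: normal_coeff_support)
      moreover have "finite {v. normal_coeff f v \<noteq> 0}"
        using f(1) by (simp add: normal_coeff_support)
      ultimately show "x \<in> V.span basis_classes"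
        unfolding V.span_def by auto
    qed
  qed
  show "V.lin_indpt basis_classes"
  proof
    assume "V.lin_dep basis_classes"
    then obtain A a v where A: "finite A" "A \<subseteq> basis_classes"
      "V.lincomb a A = \<zero>\<^bsub>genus2_alg \<kappa>\<^esub>" "v \<in> A" "a v \<noteq> 0"
      by (auto simp: V.lin_dep_def)
    obtain A' where A': "finite A'" "A' \<subseteq> normal_monomials" "A = (\<lambda>b. cls \<kappa> (mono_poly b)) ` A'"
      using finite_subset_image[OF A(1,2)] by blast
    define f where "f = (\<Sum>b\<in>A'. const (a (cls \<kappa> (mono_poly b))) * mono_poly b)"
    have lookup: "Poly_Mapping.lookup f m = (if m \<in> A' then a (cls \<kappa> (mono_poly m)) else 0)" for m
    proof -
      have "Poly_Mapping.lookup f m = (\<Sum>b\<in>A'. if b = m then a (cls \<kappa> (mono_poly b)) else 0)"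
        unfolding f_def lookup_sum
        by (intro sum.cong) (auto simp: const_def mono_poly_def mult_single lookup_single when_def)
      then show ?thesis using A'(1) by simp
    qed
    have "cls \<kappa> f = cls \<kappa> 0"
      using A(3) lincomb_cls[OF A'(1) inj_on_subset[OF inj_on_normal A'(2)], of a]
      by (simp add: A'(3) f_def cls_0)
    moreover have "Poly_Mapping.keys f \<subseteq> normal_monomials"
      using A'(2) by (auto simp: in_keys_iff lookup split: if_splits)
    ultimately have "f = 0" using normal_form_unique[of f 0] by simp
    moreover obtain m where "m \<in> A'" "v = cls \<kappa> (mono_poly m)" using A(4) A'(3) by auto
    ultimately show False using lookup[of m] A(5) by simp
  qed
qed

lemma monomial_basis_normal: "monomial_basis \<kappa> normal_monomials"
  using inj_on_normal normal_basis by (simp add: monomial_basis_def)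

lemma coordinates_normal:
  assumes "Poly_Mapping.keys f \<subseteq> normal_monomials"
  shows "V.coordinates basis_classes (cls \<kappa> f) = normal_coeff f"
  unfolding V.coordinates_def
proof (rule the1_equality[OF V.coordinates_ex1[OF normal_basis]])
  show "cls \<kappa> f \<in> carrier (genus2_alg \<kappa>)" by (simp add: carrier_genus2_alg)
  show "normal_coeff f \<in> UNIV \<rightarrow> carrier class_ring \<and>
      finite {v. normal_coeff f v \<noteq> \<zero>\<^bsub>class_ring\<^esub>} \<and>
      {v. normal_coeff f v \<noteq> \<zero>\<^bsub>class_ring\<^esub>} \<subseteq> basis_classes \<and>
      V.lincomb (normal_coeff f) {v. normal_coeff f v \<noteq> \<zero>\<^bsub>class_ring\<^esub>} = cls \<kappa> f"
    using assms lincomb_normal_coeff[OF assms] by (auto simp: normal_coeff_support)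
qed

lemma structure_constant_normal:
  assumes "normal_terms p" "mono_poly (m1 + m2) - val \<kappa> p \<in> rel_ideal \<kappa>" "m \<in> normal_monomials"
  shows "structure_constant \<kappa> normal_monomials m1 m2 m = Poly_Mapping.lookup (val \<kappa> p) m"
proof -
  have "cls \<kappa> (mono_poly m1) \<otimes>\<^bsub>genus2_alg \<kappa>\<^esub> cls \<kappa> (mono_poly m2) = cls \<kappa> (val \<kappa> p)"
    using assms(2) by (simp add: cls_mult cls_eq_iff mono_poly_def mult_single)
  then show ?thesis
    using assms(3) keys_val_normal[OF assms(1), of \<kappa>]
    by (simp add: structure_constant_def coordinates_normal normal_coeff_cls)
qed

end


section \<open>Specialization of the structure constants\<close>

lemma laurent_add:
  assumes "x \<in> laurent" "y \<in> laurent"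
  shows "x + y \<in> laurent" "specialize_1 (x + y) = specialize_1 x + specialize_1 y"
proof -
  obtain p n q m where x: "x = Fract p (Polynomial.monom 1 n)" and y: "y = Fract q (Polynomial.monom 1 m)"
    using assms by (auto simp: laurent_def)
  have eq: "x + y = Fract (p * Polynomial.monom 1 m + q * Polynomial.monom 1 n) (Polynomial.monom 1 (n + m))"
    by (simp add: x y monom_eq_0_iff mult_monom)
  show "x + y \<in> laurent" unfolding eq laurent_def by blast
  show "specialize_1 (x + y) = specialize_1 x + specialize_1 y"
    unfolding eq specialize_1_Fract by (simp add: x y specialize_1_Fract poly_monom)
qed

lemma laurent_mult:
  assumes "x \<in> laurent" "y \<in> laurent"
  shows "x * y \<in> laurent" "specialize_1 (x * y) = specialize_1 x * specialize_1 y"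
proof -
  obtain p n q m where x: "x = Fract p (Polynomial.monom 1 n)" and y: "y = Fract q (Polynomial.monom 1 m)"
    using assms by (auto simp: laurent_def)
  have eq: "x * y = Fract (p * q) (Polynomial.monom 1 (n + m))"
    by (simp add: x y mult_monom)
  show "x * y \<in> laurent" unfolding eq laurent_def by blast
  show "specialize_1 (x * y) = specialize_1 x * specialize_1 y"
    unfolding eq specialize_1_Fract by (simp add: x y specialize_1_Fract)
qed

lemma laurent_of_int: "of_int c \<in> laurent" "specialize_1 (of_int c) = of_int c"
proof -
  have nat: "of_nat n = Fract (of_nat n) (1 :: complex poly)" for n
    by (simp add: of_nat_fract)
  have eq: "(of_int c :: complex poly fract) = Fract (of_int c) (Polynomial.monom 1 0)"
    by (cases c rule: int_cases2) (simp_all add: nat)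
  show "of_int c \<in> laurent" unfolding eq laurent_def by blast
  show "specialize_1 (of_int c) = of_int c" unfolding eq specialize_1_Fract by simp
qed

lemma laurent_kappa_power: "kappa_t ^ k \<in> laurent" "specialize_1 (kappa_t ^ k) = 2 ^ k"
proof (induction k)
  case 0
  case 1
  show ?case using laurent_of_int(1)[of 1] by simp
  case 2
  show ?case using laurent_of_int(2)[of 1] by simp
next
  case (Suc k)
  case 1
  show ?case using laurent_mult(1)[OF specialize_1_kappa_t(1) Suc(1)] by simp
  case 2
  show ?case using laurent_mult(2)[OF specialize_1_kappa_t(1) Suc(1)] Suc(2) specialize_1_kappa_t(2) by simp
qed

text \<open>
  The coefficients of a term list are polynomials in \<open>\<kappa>\<close> with integer coefficients, and \<open>kappa_t\<close>
  specializes to 2.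
\<close>

lemma lookup_val_laurent:
  "Poly_Mapping.lookup (val kappa_t p) m \<in> laurent \<and>
   specialize_1 (Poly_Mapping.lookup (val kappa_t p) m) = Poly_Mapping.lookup (val 2 p) m"
proof (induction p)
  case Nil
  show ?case using laurent_of_int[of 0] by simp
next
  case (Cons t p)
  have "Poly_Mapping.lookup (trm_val kappa_t t) m \<in> laurent \<and>
      specialize_1 (Poly_Mapping.lookup (trm_val kappa_t t) m) = Poly_Mapping.lookup (trm_val 2 t) m"
    using laurent_of_int[of 0] laurent_of_int[of "trm_coeff t"] laurent_kappa_power[of "trm_exp t"]
      laurent_mult[of "of_int (trm_coeff t)" "kappa_t ^ trm_exp t"]
    by (auto simp: trm_val_def lookup_single when_def)
  then show ?case
    using Cons laurent_add by (simp add: lookup_add)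
qed

lemma unit_kappa_t: "unit_kappa kappa_t"
proof
  show "kappa_t \<noteq> 0"
    using specialize_1_kappa_t(2) laurent_of_int(2)[of 0] by auto
  show "(2 :: complex poly fract) \<noteq> 0"
    using laurent_of_int(2)[of 2] laurent_of_int(2)[of 0] by auto
qed

lemma unit_kappa_2: "unit_kappa (2 :: complex)"
  by unfold_locales simp_all

theorem theorem27:
  shows "\<exists>B :: monomial set.
    monomial_basis kappa_t B \<and> monomial_basis (2 :: complex) B \<and>
    (\<forall>m1\<in>B. \<forall>m2\<in>B. \<forall>m\<in>B.
       structure_constant kappa_t B m1 m2 m \<in> laurent \<and>
       specialize_1 (structure_constant kappa_t B m1 m2 m) = structure_constant 2 B m1 m2 m)"
proof (intro exI conjI ballI)
  show "monomial_basis kappa_t normal_monomials" "monomial_basis (2 :: complex) normal_monomials"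
    using unit_kappa.monomial_basis_normal unit_kappa_t unit_kappa_2 by blast+
  fix m1 m2 m
  assume m: "m \<in> normal_monomials"
  obtain p where p: "normal_terms p" "mono_poly (m1 + m2) - val kappa_t p \<in> rel_ideal kappa_t"
    "mono_poly (m1 + m2) - val (2 :: complex) p \<in> rel_ideal 2"
    using joint_normal_form_monomial[OF unit_kappa_t unit_kappa_2, of "m1 + m2"]
    unfolding joint_normal_form_def[OF unit_kappa_t unit_kappa_2] by blast
  show "structure_constant kappa_t normal_monomials m1 m2 m \<in> laurent"
    "specialize_1 (structure_constant kappa_t normal_monomials m1 m2 m)
       = structure_constant 2 normal_monomials m1 m2 m"
    using lookup_val_laurent[of p m]
      unit_kappa.structure_constant_normal[OF unit_kappa_t p(1,2) m]
      unit_kappa.structure_constant_normal[OF unit_kappa_2 p(1,3) m] by simp_all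
qed

end
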